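(* There exists $Z_{XY} \in \mathfrak{X}^{S^1}_2$ (that is, with $X$ an affine vector field with a singularity of saddle type and $\operatorname{div}(X)=0$ inside $S^1$, and $Y$ an affine vector field with a singularity of center type outside $S^1$) that has exactly two crossing limit cycles that intersect $S^1$ in two points.
   Context: Let $S^1=\{(x,y)\in\mathbb R^2: x^2+y^2=1\}$ and $h(x,y)=x^2+y^2-1$. For smooth vector fields $X,Y$ on $\mathbb R^2$, $Z_{XY}$ denotes the piecewise smooth vector field equal to $X$ where $h\le 0$ and to $Y$ where $h\ge 0$, with Filippov's convention on $S^1$. Write $Xh=\langle X,\nabla h\rangle$ and $Yh=\langle Y,\nabla h\rangle$. The crossing region is $\{z\in S^1: Xh(z)\,Yh(z)>0\}$; there, trajectories of $X$ and $Y$ are concatenated. A crossing periodic orbit is a closed nonconstant trajectory of $Z_{XY}$, obtained by concatenating arcs of $X$-trajectories in $h\le 0$ and arcs of $Y$-trajectories in $h\ge 0$, that meets $S^1$ only at points of the crossing region. A crossing limit cycle is a crossing periodic orbit having a neighbourhood that contains no other periodic orbit. "Intersects $S^1$ in two points" means that each such cycle meets $S^1$ in exactly two distinct points. "Linear vector field" means an affine vector field $z\mapsto Az+b$. Its singularity (possibly anywhere in the plane) is of center type if $A$ has nonzero purely imaginary eigenvalues, and of saddle type if $A$ has real eigenvalues of opposite signs. $\mathfrak{X}^{S^1}_2$ is the set of $Z_{XY}$ with $X$ linear with a singularity of saddle type and $\operatorname{div}(X)=0$, and $Y$ linear with a singularity of center type. *)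

theory Defs
  imports "HOL-Analysis.Analysis"
begin

type_synonym plane = "real ^ 2"
type_synonym vfield = "plane \<Rightarrow> plane"

section \<open>Switching manifold and Lie derivatives\<close>

definition hfun :: "plane \<Rightarrow> real" where
  "hfun z = (z $ 1)\<^sup>2 + (z $ 2)\<^sup>2 - 1"

definition S1 :: "plane set" where
  "S1 = {z. (z $ 1)\<^sup>2 + (z $ 2)\<^sup>2 = 1}"

definition grad_h :: "plane \<Rightarrow> plane" where
  "grad_h z = vector [2 * z $ 1, 2 * z $ 2]"

lemma GDERIV_hfun: "GDERIV hfun z :> grad_h z"
proof -
  have "(hfun has_derivative (\<lambda>w. 2 * z $ 1 * w $ 1 + 2 * z $ 2 * w $ 2)) (at z)"
    unfolding hfun_def[abs_def]
    by (auto intro!: derivative_eq_intros bounded_linear.has_derivative[OF bounded_linear_vec_nth]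
        simp: algebra_simps)
  then show ?thesis
    by (simp add: gderiv_def grad_h_def inner_vec_def sum_2 mult.commute)
qed

definition lie_h :: "vfield \<Rightarrow> plane \<Rightarrow> real" where
  "lie_h X z = X z \<bullet> grad_h z"

definition crossing_region :: "vfield \<Rightarrow> vfield \<Rightarrow> plane set" where
  "crossing_region X Y = {z \<in> S1. lie_h X z * lie_h Y z > 0}"

section \<open>Trajectories and periodic orbits of the piecewise smooth field\<close>

text \<open>Throughout, the piecewise smooth field equal to \<open>X\<close> on \<open>h \<le> 0\<close> and to \<open>Y\<close> on \<open>h \<ge> 0\<close>
  is represented by the pair \<open>X\<close>, \<open>Y\<close>.\<close>

definition filippov_set :: "vfield \<Rightarrow> vfield \<Rightarrow> plane \<Rightarrow> plane set" where
  "filippov_set X Y z =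
     (if hfun z < 0 then {X z}
      else if hfun z > 0 then {Y z}
      else closed_segment (X z) (Y z))"

text \<open>Filippov solutions are the absolutely continuous curves satisfying the differential
  inclusion almost everywhere. Absolute continuity is expressed by saying that the curve is an
  indefinite Lebesgue integral; \<open>v\<close> is its almost everywhere derivative.\<close>

definition filippov_solution :: "vfield \<Rightarrow> vfield \<Rightarrow> (real \<Rightarrow> plane) \<Rightarrow> real \<Rightarrow> real \<Rightarrow> bool" where
  "filippov_solution X Y \<gamma> a b \<longleftrightarrow>
     (\<exists>v N. v absolutely_integrable_on {a..b} \<and>
            (\<forall>t\<in>{a..b}. \<gamma> t = \<gamma> a + integral {a..t} v) \<and>
            negligible N \<and>
            (\<forall>t\<in>{a..b} - N. v t \<in> filippov_set X Y (\<gamma> t)))"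

definition closed_nonconstant :: "(real \<Rightarrow> plane) \<Rightarrow> real \<Rightarrow> bool" where
  "closed_nonconstant \<gamma> T \<longleftrightarrow> 0 < T \<and> \<gamma> T = \<gamma> 0 \<and> (\<exists>t\<in>{0..T}. \<gamma> t \<noteq> \<gamma> 0)"

text \<open>Orbits are identified with their images, so that reparametrisations by a time shift or by
  a multiple of the period are not counted separately.\<close>

definition periodic_orbit :: "vfield \<Rightarrow> vfield \<Rightarrow> plane set \<Rightarrow> bool" where
  "periodic_orbit X Y \<Gamma> \<longleftrightarrow>
     (\<exists>\<gamma> T. closed_nonconstant \<gamma> T \<and> \<Gamma> = \<gamma> ` {0..T} \<and> filippov_solution X Y \<gamma> 0 T)"

definition arc_of :: "vfield \<Rightarrow> (real \<Rightarrow> plane) \<Rightarrow> real \<Rightarrow> real \<Rightarrow> bool" where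
  "arc_of X \<gamma> a b \<longleftrightarrow>
     (\<forall>t\<in>{a..b}. (\<gamma> has_vector_derivative X (\<gamma> t)) (at t within {a..b}))"

definition concatenation_of_arcs ::
    "vfield \<Rightarrow> vfield \<Rightarrow> (real \<Rightarrow> plane) \<Rightarrow> real \<Rightarrow> bool" where
  "concatenation_of_arcs X Y \<gamma> T \<longleftrightarrow>
     (\<exists>(n::nat) s. s 0 = 0 \<and> s n = T \<and>
        (\<forall>i<n. s i < s (Suc i) \<and>
           (arc_of X \<gamma> (s i) (s (Suc i)) \<and> (\<forall>t\<in>{s i..s (Suc i)}. hfun (\<gamma> t) \<le> 0) \<or>
            arc_of Y \<gamma> (s i) (s (Suc i)) \<and> (\<forall>t\<in>{s i..s (Suc i)}. hfun (\<gamma> t) \<ge> 0))))"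

definition crossing_periodic_orbit :: "vfield \<Rightarrow> vfield \<Rightarrow> plane set \<Rightarrow> bool" where
  "crossing_periodic_orbit X Y \<Gamma> \<longleftrightarrow>
     (\<exists>\<gamma> T. closed_nonconstant \<gamma> T \<and> \<Gamma> = \<gamma> ` {0..T} \<and> concatenation_of_arcs X Y \<gamma> T) \<and>
     \<Gamma> \<inter> S1 \<subseteq> crossing_region X Y"

definition crossing_limit_cycle :: "vfield \<Rightarrow> vfield \<Rightarrow> plane set \<Rightarrow> bool" where
  "crossing_limit_cycle X Y \<Gamma> \<longleftrightarrow>
     crossing_periodic_orbit X Y \<Gamma> \<and>
     (\<exists>U. open U \<and> \<Gamma> \<subseteq> U \<and> (\<forall>\<Gamma>'. periodic_orbit X Y \<Gamma>' \<and> \<Gamma>' \<subseteq> U \<longrightarrow> \<Gamma>' = \<Gamma>))"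

section \<open>Linear vector fields of saddle and center type\<close>

text \<open>Complex eigenvalues of a real matrix.\<close>

definition eigenvalues :: "real ^ 2 ^ 2 \<Rightarrow> complex set" where
  "eigenvalues A =
     {c. \<exists>v :: complex ^ 2. v \<noteq> 0 \<and> (\<chi> i j. complex_of_real (A $ i $ j)) *v v = c *s v}"

text \<open>In both cases the matrix is invertible, so the field has exactly one singularity.\<close>

definition linear_saddle :: "vfield \<Rightarrow> bool" where
  "linear_saddle X \<longleftrightarrow>
     (\<exists>A b. X = (\<lambda>z. A *v z + b) \<and>
        (\<exists>\<nu> \<mu> :: real. \<nu> < 0 \<and> 0 < \<mu> \<and> eigenvalues A = {complex_of_real \<nu>, complex_of_real \<mu>}))"

definition linear_center :: "vfield \<Rightarrow> bool" where
  "linear_center Y \<longleftrightarrow>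
     (\<exists>A b. Y = (\<lambda>z. A *v z + b) \<and>
        (\<exists>\<omega> :: real. \<omega> \<noteq> 0 \<and>
           eigenvalues A = {\<i> * complex_of_real \<omega>, - (\<i> * complex_of_real \<omega>)}))"

definition divergence :: "vfield \<Rightarrow> plane \<Rightarrow> real" where
  "divergence X z = trace (jacobian X (at z))"

definition X_S1_2 :: "(vfield \<times> vfield) set" where
  "X_S1_2 = {(X, Y). linear_saddle X \<and> (\<forall>z. divergence X z = 0) \<and> linear_center Y}"

end

theory Submission
  imports Defs
begin

text \<open>
  Take \<open>X(x, y) = (2 - x, y - 2/5)\<close> and \<open>Y(x, y) = (7 y + 9/5, - 6 x - 1/2)\<close>. Both fields are Hamiltonian,
  with quadratic first integrals \<open>H\<^sub>X\<close> and \<open>H\<^sub>Y\<close>, so a crossing orbit that leaves the disc at \<open>p\<close> and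
  re-enters it at \<open>q\<close>, and meets the circle nowhere else, satisfies \<open>H\<^sub>X(p) = H\<^sub>X(q)\<close> and
  \<open>H\<^sub>Y(p) = H\<^sub>Y(q)\<close>. For a quadratic \<open>H\<close> and two points of the circle with midpoint \<open>m\<close>,
  \<open>H(p) - H(q)\<close> is a multiple of the Lie derivative of \<open>h\<close> at \<open>m\<close>, so \<open>m\<close> lies on two conics through the
  origin. Besides the origin they meet in three points: two inside the disc, which give the chords
  \<open>x + 2 y + 2 = 0\<close> and \<open>x + 3 y + 1 = 0\<close> of the two cycles, and one outside.

  The cycles are isolated among all Filippov orbits because an orbit near such a cycle alternates
  between short arcs of the circle around \<open>p\<close> and \<open>q\<close> on which \<open>H\<^sub>X\<close> and \<open>H\<^sub>Y\<close> are strictly monotone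
  in the same sense. The return map is therefore increasing, its extremal points on a periodic orbit
  are fixed, and fixed points are again solutions of the two equations.
\<close>

section \<open>Filippov solutions\<close>

lemma filippov_solutionI:
  assumes "v absolutely_integrable_on {a..b}" "\<And>t. t \<in> {a..b} \<Longrightarrow> \<gamma> t = \<gamma> a + integral {a..t} v"
    "negligible N" "\<And>t. t \<in> {a..b} - N \<Longrightarrow> v t \<in> filippov_set X Y (\<gamma> t)"
  shows "filippov_solution X Y \<gamma> a b"
  unfolding filippov_solution_def using assms by blast

lemma filippov_solution_subinterval:
  assumes "filippov_solution X Y \<gamma> a b" "a \<le> c" "d \<le> b"
  shows "filippov_solution X Y \<gamma> c d"
proof (cases "c \<le> d")
  \<comment> \<open>For \<open>c > d\<close> the interval \<open>{c..d}\<close> is empty, so the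
    zero function and an empty null set serve.\<close>
  case False
  then show ?thesis
    unfolding filippov_solution_def
    by (intro exI[of _ "\<lambda>_. 0"] exI[of _ "{}"]) auto
next
  case True
  from assms(1) obtain v N where v: "v absolutely_integrable_on {a..b}"
    "\<forall>t\<in>{a..b}. \<gamma> t = \<gamma> a + integral {a..t} v" "negligible N"
    "\<forall>t\<in>{a..b} - N. v t \<in> filippov_set X Y (\<gamma> t)"
    unfolding filippov_solution_def by blast
  have int: "v integrable_on {a..b}"
    using v(1) by (rule set_lebesgue_integral_eq_integral(1))
  have eq: "\<gamma> t = \<gamma> c + integral {c..t} v" if t: "t \<in> {c..d}" for t
  proof -
    have "integral {a..c} v + integral {c..t} v = integral {a..t} v"
      using t assms(2,3) True
      by (intro Henstock_Kurzweil_Integration.integral_combine integrable_subinterval_real[OF int]) auto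
    moreover have "\<gamma> c = \<gamma> a + integral {a..c} v" "\<gamma> t = \<gamma> a + integral {a..t} v"
      using bspec[OF v(2), of c] bspec[OF v(2), of t] t assms(2,3) True
      by (metis atLeastAtMost_iff order_trans)+
    ultimately show ?thesis by (simp add: algebra_simps)
  qed
  have "v absolutely_integrable_on {c..d}"
    by (rule absolutely_integrable_on_subinterval[OF v(1)]) (use assms(2,3) in auto)
  then show ?thesis
    by (rule filippov_solutionI[OF _ eq v(3)]) (use v(4) assms(2,3) in auto)
qed

lemma filippov_solution_join:
  assumes "filippov_solution X Y \<gamma> a b" "filippov_solution X Y \<gamma> b c" "a \<le> b" "b \<le> c"
  shows "filippov_solution X Y \<gamma> a c"
proof -
  from assms(1) obtain v N where v: "v absolutely_integrable_on {a..b}"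
    "\<forall>t\<in>{a..b}. \<gamma> t = \<gamma> a + integral {a..t} v" "negligible N"
    "\<forall>t\<in>{a..b} - N. v t \<in> filippov_set X Y (\<gamma> t)"
    unfolding filippov_solution_def by blast
  from assms(2) obtain w M where w: "w absolutely_integrable_on {b..c}"
    "\<forall>t\<in>{b..c}. \<gamma> t = \<gamma> b + integral {b..t} w" "negligible M"
    "\<forall>t\<in>{b..c} - M. w t \<in> filippov_set X Y (\<gamma> t)"
    unfolding filippov_solution_def by blast
  \<comment> \<open>At \<open>b\<close> the value of \<open>v\<close> is kept; on the second
    interval \<open>u\<close> and \<open>w\<close> then differ at most at this one point, which
    integrals do not see.\<close>
  define u where "u = (\<lambda>t. if t \<le> b then v t else w t)"
  have u1: "u absolutely_integrable_on {a..b}"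
    using v(1) by (rule absolutely_integrable_spike[where S="{}"]) (auto simp: u_def)
  have u2: "u absolutely_integrable_on {b..c}"
    using w(1) by (rule absolutely_integrable_spike[where S="{b}"]) (auto simp: u_def)
  have u: "u absolutely_integrable_on {a..c}"
    using absolutely_integrable_Un[OF u1 u2] assms(3,4) by (simp add: ivl_disj_un_two_touch)
  have uint: "u integrable_on {a..c}"
    using u by (rule set_lebesgue_integral_eq_integral(1))
  have iv: "integral {a..t} u = integral {a..t} v" if "t \<le> b" for t
    by (rule integral_cong) (use that in \<open>auto simp: u_def\<close>)
  have iw: "integral {b..t} u = integral {b..t} w" for t
    by (rule integral_spike[of "{b}"]) (auto simp: u_def)
  have eq: "\<gamma> t = \<gamma> a + integral {a..t} u" if t: "t \<in> {a..c}" for t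
  proof (cases "t \<le> b")
    case True
    then show ?thesis using bspec[OF v(2), of t] iv[OF True] t by simp
  next
    case False
    have "integral {a..b} u + integral {b..t} u = integral {a..t} u"
      using False t assms(3)
      by (intro Henstock_Kurzweil_Integration.integral_combine integrable_subinterval_real[OF uint]) auto
    moreover have "\<gamma> b = \<gamma> a + integral {a..b} u"
      using bspec[OF v(2), of b] assms(3) iv[of b] by simp
    moreover have "\<gamma> t = \<gamma> b + integral {b..t} u"
      using bspec[OF w(2), of t] False t by (simp only: iw) auto
    ultimately show ?thesis by (simp add: algebra_simps)
  qed
  have "\<forall>t\<in>{a..c} - (N \<union> M). u t \<in> filippov_set X Y (\<gamma> t)"
    using v(4) w(4) by (auto simp: u_def)
  then show ?thesis
    by (intro filippov_solutionI[OF u eq, of "N \<union> M"]) (use v(3) w(3) in auto)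
qed

lemma filippov_solution_shift:
  assumes "filippov_solution X Y \<gamma> a b"
  shows "filippov_solution X Y (\<lambda>t. \<gamma> (t + s)) (a - s) (b - s)"
proof -
  from assms(1) obtain v N where v: "v absolutely_integrable_on {a..b}"
    "\<forall>t\<in>{a..b}. \<gamma> t = \<gamma> a + integral {a..t} v" "negligible N"
    "\<forall>t\<in>{a..b} - N. v t \<in> filippov_set X Y (\<gamma> t)"
    unfolding filippov_solution_def by blast
  have ai: "(\<lambda>t. v (t + s)) absolutely_integrable_on {a - s..b - s}"
    using v(1) unfolding absolutely_integrable_on_def by (auto intro: integrable_shift_real_ivl)
  have eq: "\<gamma> (t + s) = \<gamma> (a - s + s) + integral {a - s..t} (\<lambda>t. v (t + s))"
    if "t \<in> {a - s..b - s}" for t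
  proof -
    have "\<gamma> (t + s) = \<gamma> a + integral {a..t + s} v" using bspec[OF v(2), of "t + s"] that by auto
    then show ?thesis using integral_shift_real_ivl[of a s "t + s" v] by simp
  qed
  have neg: "negligible ((+) (-s) ` N)"
    by (rule negligible_translation[OF v(3)])
  have incl: "\<forall>t\<in>{a - s..b - s} - (+) (-s) ` N. v (t + s) \<in> filippov_set X Y (\<gamma> (t + s))"
  proof
    fix t assume t: "t \<in> {a - s..b - s} - (+) (-s) ` N"
    have "t + s \<notin> N"
    proof
      assume "t + s \<in> N"
      then have "(-s) + (t + s) \<in> (+) (-s) ` N" by (rule imageI)
      then show False using t by simp
    qed
    then show "v (t + s) \<in> filippov_set X Y (\<gamma> (t + s))" using t v(4) by auto
  qed
  show ?thesis by (rule filippov_solutionI[OF ai eq neg]) (use incl in blast)+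
qed

lemma filippov_solution_cong:
  assumes "filippov_solution X Y \<gamma> a b" "\<And>t. t \<in> {a..b} \<Longrightarrow> \<delta> t = \<gamma> t"
  shows "filippov_solution X Y \<delta> a b"
proof -
  from assms(1) obtain v N where v: "v absolutely_integrable_on {a..b}"
    "\<forall>t\<in>{a..b}. \<gamma> t = \<gamma> a + integral {a..t} v" "negligible N"
    "\<forall>t\<in>{a..b} - N. v t \<in> filippov_set X Y (\<gamma> t)"
    unfolding filippov_solution_def by blast
  have eq: "\<delta> t = \<delta> a + integral {a..t} v" if "t \<in> {a..b}" for t
    using bspec[OF v(2) that] assms(2)[OF that] assms(2)[of a] that by auto
  show ?thesis
    by (rule filippov_solutionI[OF v(1) eq v(3)]) (use v(4) assms(2) in auto)
qed

lemma filippov_solution_continuous: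
  assumes "filippov_solution X Y \<gamma> a b"
  shows "continuous_on {a..b} \<gamma>"
proof -
  from assms(1) obtain v N where v: "v absolutely_integrable_on {a..b}"
    "\<forall>t\<in>{a..b}. \<gamma> t = \<gamma> a + integral {a..t} v"
    unfolding filippov_solution_def by blast
  have "v integrable_on {a..b}"
    using v(1) by (rule set_lebesgue_integral_eq_integral(1))
  then have "continuous_on {a..b} (\<lambda>t. \<gamma> a + integral {a..t} v)"
    by (intro continuous_intros indefinite_integral_continuous_1)
  then show ?thesis
    by (rule continuous_on_eq) (use v(2) in metis)
qed

text \<open>Where the Filippov set is a single vector, the almost everywhere derivative equals the
  continuous function \<open>W (\<gamma> t)\<close> off a null set, and the fundamental theorem of
  calculus upgrades it to a derivative at every time. The condition is placed on the open interval
  because the ends of an arc normally lie on the circle.\<close>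

lemma filippov_solution_arc_of:
  assumes "filippov_solution X Y \<gamma> a b" "continuous_on UNIV W"
    "\<And>t. a < t \<Longrightarrow> t < b \<Longrightarrow> filippov_set X Y (\<gamma> t) = {W (\<gamma> t)}"
  shows "arc_of W \<gamma> a b"
proof -
  from assms(1) obtain v N where v: "v absolutely_integrable_on {a..b}"
    "\<forall>t\<in>{a..b}. \<gamma> t = \<gamma> a + integral {a..t} v" "negligible N"
    "\<forall>t\<in>{a..b} - N. v t \<in> filippov_set X Y (\<gamma> t)"
    unfolding filippov_solution_def by blast
  have eq: "\<gamma> t = \<gamma> a + integral {a..t} (\<lambda>t. W (\<gamma> t))" if "t \<in> {a..b}" for t
  proof -
    have "integral {a..t} v = integral {a..t} (\<lambda>t. W (\<gamma> t))"
    proof (rule integral_spike)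
      show "negligible (N \<union> {a, b})" using v(3) by auto
      show "W (\<gamma> u) = v u" if u: "u \<in> {a..t} - (N \<union> {a, b})" for u
        using bspec[OF v(4), of u] assms(3)[of u] u \<open>t \<in> {a..b}\<close> by auto
    qed
    then show ?thesis using bspec[OF v(2) that] by simp
  qed
  have cont: "continuous_on {a..b} (\<lambda>t. W (\<gamma> t))"
    by (rule continuous_on_compose2[OF assms(2) filippov_solution_continuous[OF assms(1)]]) simp
  show ?thesis
    unfolding arc_of_def
  proof
    fix t assume t: "t \<in> {a..b}"
    have "((\<lambda>u. \<gamma> a + integral {a..u} (\<lambda>t. W (\<gamma> t))) has_vector_derivative 0 + W (\<gamma> t))
      (at t within {a..b})"
      by (intro has_vector_derivative_add has_vector_derivative_const
          integral_has_vector_derivative[OF cont t])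
    then have "((\<lambda>u. \<gamma> a + integral {a..u} (\<lambda>t. W (\<gamma> t))) has_vector_derivative W (\<gamma> t))
      (at t within {a..b})" by simp
    then show "(\<gamma> has_vector_derivative W (\<gamma> t)) (at t within {a..b})"
      by (rule has_vector_derivative_transform[OF t, rotated]) (use eq in metis)
  qed
qed

lemma arc_of_filippov_solution:
  assumes "arc_of W \<gamma> a b" "a \<le> b" "continuous_on UNIV W"
    "\<And>t. t \<in> {a..b} \<Longrightarrow> W (\<gamma> t) \<in> filippov_set X Y (\<gamma> t)"
  shows "filippov_solution X Y \<gamma> a b"
proof -
  have c: "continuous_on {a..b} \<gamma>"
    using assms(1) unfolding arc_of_def
    by (intro continuous_on_vector_derivative) blast
  have "continuous_on {a..b} (\<lambda>t. W (\<gamma> t))"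
    by (rule continuous_on_compose2[OF assms(3) c]) simp
  then have ai: "(\<lambda>t. W (\<gamma> t)) absolutely_integrable_on {a..b}"
    by (rule absolutely_integrable_continuous_real)
  have hi: "((\<lambda>t. W (\<gamma> t)) has_integral \<gamma> t - \<gamma> a) {a..t}" if "t \<in> {a..b}" for t
  proof (rule fundamental_theorem_of_calculus)
    show "(\<gamma> has_vector_derivative W (\<gamma> u)) (at u within {a..t})" if "u \<in> {a..t}" for u
      using assms(1) that \<open>t \<in> {a..b}\<close> unfolding arc_of_def
      by (intro has_vector_derivative_within_subset[where S = "{a..b}" and T = "{a..t}"]) auto
  qed (use that in auto)
  have eq: "\<gamma> t = \<gamma> a + integral {a..t} (\<lambda>t. W (\<gamma> t))" if "t \<in> {a..b}" for t
    using integral_unique[OF hi[OF that]] by simp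
  show ?thesis
    by (rule filippov_solutionI[OF ai eq negligible_empty]) (use assms(4) in blast)+
qed

lemma concatenation_filippov_solution:
  assumes "concatenation_of_arcs X Y \<gamma> T" "continuous_on UNIV X" "continuous_on UNIV Y"
  shows "filippov_solution X Y \<gamma> 0 T"
proof -
  obtain n :: nat and s where s: "s 0 = 0" "s n = T"
    "\<forall>i<n. s i < s (Suc i) \<and>
           (arc_of X \<gamma> (s i) (s (Suc i)) \<and> (\<forall>t\<in>{s i..s (Suc i)}. hfun (\<gamma> t) \<le> 0) \<or>
            arc_of Y \<gamma> (s i) (s (Suc i)) \<and> (\<forall>t\<in>{s i..s (Suc i)}. hfun (\<gamma> t) \<ge> 0))"
    using assms(1) unfolding concatenation_of_arcs_def by (elim exE conjE)
  have "0 \<le> s k \<and> filippov_solution X Y \<gamma> 0 (s k)" if "k \<le> n" for k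
    using that
  proof (induction k)
    case 0
    \<comment> \<open>The initial interval is the single point 0, itself a null set, so no inclusion
      has to be checked.\<close>
    show ?case unfolding s(1) by (intro conjI filippov_solutionI[where v = "\<lambda>_. 0" and N = "{0}"]) auto
  next
    case (Suc k)
    then have k: "k < n" "0 \<le> s k" "filippov_solution X Y \<gamma> 0 (s k)" by auto
    have lt: "s k < s (Suc k)" using s(3) k(1) by blast
    have "filippov_solution X Y \<gamma> (s k) (s (Suc k))"
      using s(3)[rule_format, OF k(1)]
    proof (elim conjE disjE)
      assume *: "arc_of X \<gamma> (s k) (s (Suc k))" "\<forall>t\<in>{s k..s (Suc k)}. hfun (\<gamma> t) \<le> 0"
      show ?thesis
      proof (rule arc_of_filippov_solution[OF *(1) less_imp_le[OF lt] assms(2)])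
        show "X (\<gamma> t) \<in> filippov_set X Y (\<gamma> t)" if "t \<in> {s k..s (Suc k)}" for t
          using bspec[OF *(2) that] unfolding filippov_set_def by auto
      qed
    next
      assume *: "arc_of Y \<gamma> (s k) (s (Suc k))" "\<forall>t\<in>{s k..s (Suc k)}. hfun (\<gamma> t) \<ge> 0"
      show ?thesis
      proof (rule arc_of_filippov_solution[OF *(1) less_imp_le[OF lt] assms(3)])
        show "Y (\<gamma> t) \<in> filippov_set X Y (\<gamma> t)" if "t \<in> {s k..s (Suc k)}" for t
          using bspec[OF *(2) that] unfolding filippov_set_def by auto
      qed
    qed
    then show ?case
      using k(2) lt filippov_solution_join[OF k(3)] by simp
  qed
  then show ?thesis using s(2) by blast
qed

section \<open>Transversal crossings of the circle\<close>

text \<open>The sign \<open>\<sigma>\<close> records the direction: 1 leaves the disc, -1 enters it.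
  Since the gradient of \<open>h\<close> at \<open>z\<close> is \<open>2 z\<close>, pairing with
  \<open>z\<close> has the sign of the Lie derivative. With both fields equal to \<open>W\<close> it
  describes a transversal crossing of one smooth field.\<close>

definition crosses :: "vfield \<Rightarrow> vfield \<Rightarrow> real \<Rightarrow> plane \<Rightarrow> bool" where
  "crosses X Y \<sigma> z \<longleftrightarrow> z \<in> S1 \<and> 0 < \<sigma> * (X z \<bullet> z) \<and> 0 < \<sigma> * (Y z \<bullet> z)"

lemma hfun_eq_inner: "hfun z = z \<bullet> z - 1"
  by (simp add: hfun_def inner_vec_def sum_2 power2_eq_square)

lemma mem_S1_iff: "z \<in> S1 \<longleftrightarrow> hfun z = 0"
  by (simp add: S1_def hfun_def)

text \<open>Factoring a difference of values of \<open>h\<close> through the displacement replaces a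
  chain rule along merely absolutely continuous curves.\<close>

lemma hfun_diff: "hfun z - hfun w = (z - w) \<bullet> (z + w)"
  by (simp add: hfun_eq_inner inner_diff_left inner_add_right inner_commute[of w z])

lemma continuous_on_hfun: "continuous_on A \<gamma> \<Longrightarrow> continuous_on A (\<lambda>t. hfun (\<gamma> t))"
  unfolding hfun_eq_inner by (intro continuous_intros)

lemma lie_h_eq: "lie_h X z = 2 * (X z \<bullet> z)"
  by (simp add: lie_h_def grad_h_def inner_vec_def sum_2)

lemma crossing_region_eq: "crossing_region X Y = {z. crosses X Y 1 z \<or> crosses X Y (-1) z}"
  by (auto simp: crossing_region_def crosses_def lie_h_eq zero_less_mult_iff)

text \<open>Both fields lie in a half-space, which is convex and hence contains the whole Filippov
  segment.\<close>

lemma filippov_set_inner_ge: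
  assumes "v \<in> filippov_set X Y z" "\<delta> \<le> X z \<bullet> u" "\<delta> \<le> Y z \<bullet> u"
  shows "\<delta> \<le> v \<bullet> u"
proof -
  have "convex {v. \<delta> \<le> v \<bullet> u}"
    using convex_halfspace_ge[of \<delta> u] by (simp add: inner_commute)
  then have "closed_segment (X z) (Y z) \<subseteq> {v. \<delta> \<le> v \<bullet> u}"
    using assms(2,3) by (intro closed_segment_subset) auto
  then show ?thesis
    using assms by (auto simp: filippov_set_def split: if_splits)
qed

lemma filippov_solution_increment:
  assumes "filippov_solution X Y \<gamma> a b" "a \<le> b"
    "\<And>t. t \<in> {a..b} \<Longrightarrow> \<delta> \<le> X (\<gamma> t) \<bullet> u" "\<And>t. t \<in> {a..b} \<Longrightarrow> \<delta> \<le> Y (\<gamma> t) \<bullet> u"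
  shows "\<delta> * (b - a) \<le> (\<gamma> b - \<gamma> a) \<bullet> u"
proof -
  from assms(1) obtain v N where v: "v absolutely_integrable_on {a..b}"
    "\<forall>t\<in>{a..b}. \<gamma> t = \<gamma> a + integral {a..t} v" "negligible N"
    "\<forall>t\<in>{a..b} - N. v t \<in> filippov_set X Y (\<gamma> t)"
    unfolding filippov_solution_def by blast
  \<comment> \<open>On the null set \<open>N\<close> nothing is known about \<open>v\<close>, so the
    integrand is reset there to \<open>\<delta>\<close>; the lower bound then holds at every time
    and the integral is unchanged.\<close>
  define g where "g = (\<lambda>t. if t \<in> N then \<delta> else v t \<bullet> u)"
  have "v integrable_on {a..b}"
    using v(1) by (rule set_lebesgue_integral_eq_integral(1))
  then have "((\<lambda>t. v t \<bullet> u) has_integral integral {a..b} v \<bullet> u) {a..b}"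
    by (intro has_integral_linear[of v _ _ "\<lambda>x. x \<bullet> u", unfolded o_def] bounded_linear_inner_left integrable_integral)
  moreover have "integral {a..b} v = \<gamma> b - \<gamma> a"
    using bspec[OF v(2), of b] assms(2) by simp
  ultimately have "((\<lambda>t. v t \<bullet> u) has_integral (\<gamma> b - \<gamma> a) \<bullet> u) {a..b}" by simp
  then have g: "(g has_integral (\<gamma> b - \<gamma> a) \<bullet> u) {a..b}"
    by (rule has_integral_spike[OF v(3), rotated]) (simp add: g_def)
  have "\<delta> \<le> g t" if "t \<in> {a..b}" for t
    using filippov_set_inner_ge[OF bspec[OF v(4)], of t \<delta> u] assms(3,4)[OF that] that
    by (auto simp: g_def)
  moreover have "((\<lambda>t. \<delta>) has_integral \<delta> * (b - a)) {a..b}"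
    using has_integral_const_real[of \<delta> a b] assms(2) by (simp add: mult.commute)
  ultimately show ?thesis
    using has_integral_le[OF _ g] by blast
qed

text \<open>Near a transversal crossing both fields have component at least \<open>\<delta>\<close>
  in direction \<open>\<sigma> u\<close> for every \<open>u\<close> close to \<open>z\<close>.
  Integration gives a displacement whose pairings with both end points have sign
  \<open>\<sigma>\<close>, and \<open>hfun_diff\<close> adds them up to the change of
  \<open>h\<close>. The radius is uniform over all solutions.\<close>

lemma crosses_hfun_increasing:
  assumes "crosses X Y \<sigma> z" "continuous_on UNIV X" "continuous_on UNIV Y"
  obtains r where "r > 0" "\<And>\<gamma> c d. c < d \<Longrightarrow> filippov_solution X Y \<gamma> c d \<Longrightarrow>
    \<gamma> ` {c..d} \<subseteq> ball z r \<Longrightarrow> \<sigma> * hfun (\<gamma> c) < \<sigma> * hfun (\<gamma> d)"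
proof -
  \<comment> \<open>The point where the fields are evaluated and the direction vary independently,
    so continuity is used on pairs.\<close>
  define f where "f = (\<lambda>p. min (\<sigma> * (X (fst p) \<bullet> snd p)) (\<sigma> * (Y (fst p) \<bullet> snd p)))"
  define \<delta> where "\<delta> = f (z, z) / 2"
  have pos: "0 < f (z, z)" using assms(1) by (simp add: f_def crosses_def)
  have "continuous_on UNIV f"
    unfolding f_def
    by (intro continuous_intros continuous_on_compose2[OF assms(2)] continuous_on_compose2[OF assms(3)]) auto
  then have "open {p. \<delta> < f p}"
    using open_Collect_less[OF continuous_on_const] by blast
  moreover have "(z, z) \<in> {p. \<delta> < f p}" using pos by (simp add: \<delta>_def)
  ultimately obtain A B where AB: "open A" "open B" "(z, z) \<in> A \<times> B" "A \<times> B \<subseteq> {p. \<delta> < f p}"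
    by (rule open_prod_elim)
  then have "open (A \<inter> B)" "z \<in> A \<inter> B" by auto
  then obtain r where r: "r > 0" "ball z r \<subseteq> A \<inter> B"
    by (meson open_contains_ball)
  have f: "\<delta> < f (w, u)" if "w \<in> ball z r" "u \<in> ball z r" for w u
    using AB(4) r(2) that by blast
  show thesis
  proof (rule that[OF r(1)])
    fix \<gamma> c d
    assume cd: "c < d" and sol: "filippov_solution X Y \<gamma> c d" and sub: "\<gamma> ` {c..d} \<subseteq> ball z r"
    have *: "0 < \<sigma> * ((\<gamma> d - \<gamma> c) \<bullet> u)" if u: "u \<in> ball z r" for u
    proof -
      have "\<delta> * (d - c) \<le> (\<gamma> d - \<gamma> c) \<bullet> (\<sigma> *\<^sub>R u)"
      proof (rule filippov_solution_increment[OF sol less_imp_le[OF cd]])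
        fix t assume "t \<in> {c..d}"
        then have "\<gamma> t \<in> ball z r" using sub by blast
        then have "\<delta> < f (\<gamma> t, u)" using u by (rule f)
        then show "\<delta> \<le> X (\<gamma> t) \<bullet> \<sigma> *\<^sub>R u" "\<delta> \<le> Y (\<gamma> t) \<bullet> \<sigma> *\<^sub>R u"
          by (auto simp: f_def)
      qed
      moreover have "0 < \<delta> * (d - c)" using pos cd by (simp add: \<delta>_def)
      ultimately show ?thesis by simp
    qed
    have "\<gamma> c \<in> ball z r" "\<gamma> d \<in> ball z r"
      by (rule subsetD[OF sub imageI], use cd in simp)+
    then have "0 < \<sigma> * ((\<gamma> d - \<gamma> c) \<bullet> \<gamma> d) + \<sigma> * ((\<gamma> d - \<gamma> c) \<bullet> \<gamma> c)"
      by (intro add_pos_pos *)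
    also have "\<dots> = \<sigma> * hfun (\<gamma> d) - \<sigma> * hfun (\<gamma> c)"
      by (simp add: hfun_diff[of "\<gamma> d" "\<gamma> c"] right_diff_distrib[symmetric] inner_add_right distrib_left)
    finally show "\<sigma> * hfun (\<gamma> c) < \<sigma> * hfun (\<gamma> d)" by simp
  qed
qed

text \<open>Monotonicity of \<open>h\<close> near the crossing point, combined with
  \<open>h = 0\<close> there, rules out sliding and touching; crossing times are therefore isolated
  zeros.\<close>

lemma crosses_sign_change:
  assumes "crosses X Y \<sigma> (\<gamma> t0)" "continuous_on UNIV X" "continuous_on UNIV Y"
    "filippov_solution X Y \<gamma> a b" "t0 \<in> {a..b}"
  obtains \<epsilon> where "\<epsilon> > 0"
    "\<And>t. t \<in> {a..b} \<Longrightarrow> t0 < t \<Longrightarrow> t < t0 + \<epsilon> \<Longrightarrow> 0 < \<sigma> * hfun (\<gamma> t)"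
    "\<And>t. t \<in> {a..b} \<Longrightarrow> t < t0 \<Longrightarrow> t0 - \<epsilon> < t \<Longrightarrow> \<sigma> * hfun (\<gamma> t) < 0"
proof -
  obtain r where r: "r > 0" "\<And>\<delta> c d. c < d \<Longrightarrow> filippov_solution X Y \<delta> c d \<Longrightarrow>
    \<delta> ` {c..d} \<subseteq> ball (\<gamma> t0) r \<Longrightarrow> \<sigma> * hfun (\<delta> c) < \<sigma> * hfun (\<delta> d)"
    using crosses_hfun_increasing[OF assms(1-3)] by metis
  have "continuous_on {a..b} \<gamma>" using assms(4) by (rule filippov_solution_continuous)
  then obtain \<epsilon> where e: "\<epsilon> > 0" "\<And>t. t \<in> {a..b} \<Longrightarrow> dist t t0 < \<epsilon> \<Longrightarrow> dist (\<gamma> t) (\<gamma> t0) < r"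
    using assms(5) r(1) unfolding continuous_on_iff by metis
  have inc: "\<sigma> * hfun (\<gamma> c) < \<sigma> * hfun (\<gamma> d)"
    if "c < d" "a \<le> c" "d \<le> b" "t0 - \<epsilon> < c" "d < t0 + \<epsilon>" for c d
  proof (rule r(2)[OF that(1) filippov_solution_subinterval[OF assms(4) that(2,3)]])
    show "\<gamma> ` {c..d} \<subseteq> ball (\<gamma> t0) r"
      using e(2) that by (auto simp: dist_commute dist_real_def abs_less_iff)
  qed
  have z: "hfun (\<gamma> t0) = 0" using assms(1) by (simp add: crosses_def mem_S1_iff)
  show thesis
  proof (rule that[OF e(1)])
    show "0 < \<sigma> * hfun (\<gamma> t)" if "t \<in> {a..b}" "t0 < t" "t < t0 + \<epsilon>" for t
      using inc[of t0 t] that assms(5) e(1) z by auto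
    show "\<sigma> * hfun (\<gamma> t) < 0" if "t \<in> {a..b}" "t < t0" "t0 - \<epsilon> < t" for t
      using inc[of t t0] that assms(5) e(1) z by auto
  qed
qed

section \<open>First and last zeros of a continuous function\<close>

lemma first_zero_right:
  fixes f :: "real \<Rightarrow> real"
  assumes "continuous_on {a..b} f" "a \<le> b" "0 < f a" "f b \<le> 0"
  obtains c where "a < c" "c \<le> b" "f c = 0" "\<And>t. a \<le> t \<Longrightarrow> t < c \<Longrightarrow> 0 < f t"
proof -
  define Z where "Z = {t \<in> {a..b}. f t = 0}"
  have zero: "\<exists>u\<in>Z. u \<le> t" if "t \<in> {a..b}" "f t \<le> 0" for t
  proof -
    have "continuous_on {a..t} f" by (rule continuous_on_subset[OF assms(1)]) (use that in auto)
    then have "\<exists>u\<ge>a. u \<le> t \<and> f u = 0"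
      using IVT2'[of f t 0 a] that assms(3) by simp
    then obtain u where "a \<le> u" "u \<le> t" "f u = 0" by blast
    then show ?thesis using that by (auto simp: Z_def)
  qed
  have "closed Z"
    unfolding Z_def by (rule continuous_closed_preimage_constant[OF assms(1)]) simp
  then have "compact ({a..b} \<inter> Z)" by (rule compact_Int_closed[OF compact_Icc])
  moreover have "{a..b} \<inter> Z = Z" by (auto simp: Z_def)
  ultimately have "compact Z" by simp
  moreover have "Z \<noteq> {}" using zero[of b] assms(2,4) by auto
  ultimately have "\<exists>c\<in>Z. \<forall>t\<in>Z. c \<le> t" by (rule compact_attains_inf)
  then obtain c where c: "c \<in> Z" "\<forall>t\<in>Z. c \<le> t" by blast
  show thesis
  proof (rule that[of c])
    show "a < c" using c(1) assms(3) by (cases "a = c") (auto simp: Z_def)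
    show "0 < f t" if "a \<le> t" "t < c" for t
    proof (rule ccontr)
      assume "\<not> 0 < f t"
      moreover have "t \<in> {a..b}" using that c(1) by (auto simp: Z_def)
      ultimately have "\<exists>u\<in>Z. u \<le> t" using zero[of t] by simp
      then obtain u where "u \<in> Z" "u \<le> t" by blast
      then show False using bspec[OF c(2), of u] that by auto
    qed
  qed (use c(1) in \<open>auto simp: Z_def\<close>)
qed

lemma last_zero_left:
  fixes f :: "real \<Rightarrow> real"
  assumes "continuous_on {a..b} f" "a \<le> b" "0 < f b" "f a \<le> 0"
  obtains c where "a \<le> c" "c < b" "f c = 0" "\<And>t. c < t \<Longrightarrow> t \<le> b \<Longrightarrow> 0 < f t"
proof -
  have "continuous_on {-b..-a} (\<lambda>t. f (- t))"
    by (rule continuous_on_compose2[OF assms(1)]) (intro continuous_intros, auto)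
  then obtain c where c: "-b < c" "c \<le> -a" "f (- c) = 0" "\<And>t. -b \<le> t \<Longrightarrow> t < c \<Longrightarrow> 0 < f (- t)"
    by (rule first_zero_right[where a = "-b" and b = "-a" and f = "\<lambda>t. f (- t)"]) (use assms(2-4) in auto)
  show thesis
    by (rule that[of "-c"]) (use c(1-3) c(4)[of "- t" for t] in simp_all)
qed

section \<open>Excursions between consecutive crossings\<close>

text \<open>The base point is put on the circle, so that every time off the circle lies strictly
  between two circle times of \<open>[0, T]\<close> and no excursion has to be continued across the
  end of the period.\<close>

definition crossing_loop :: "vfield \<Rightarrow> vfield \<Rightarrow> (real \<Rightarrow> plane) \<Rightarrow> real \<Rightarrow> bool" where
  "crossing_loop X Y \<gamma> T \<longleftrightarrow> 0 < T \<and> \<gamma> T = \<gamma> 0 \<and> \<gamma> 0 \<in> S1 \<and> filippov_solution X Y \<gamma> 0 T \<and>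
     \<gamma> ` {0..T} \<inter> S1 \<subseteq> crossing_region X Y"

definition excursion :: "vfield \<Rightarrow> vfield \<Rightarrow> (real \<Rightarrow> plane) \<Rightarrow> real \<Rightarrow> real \<Rightarrow> real \<Rightarrow> real \<Rightarrow> bool" where
  "excursion X Y \<gamma> T \<sigma> a b \<longleftrightarrow> 0 \<le> a \<and> a < b \<and> b \<le> T \<and> crosses X Y \<sigma> (\<gamma> a) \<and> crosses X Y (- \<sigma>) (\<gamma> b) \<and>
     (\<forall>t. a < t \<longrightarrow> t < b \<longrightarrow> 0 < \<sigma> * hfun (\<gamma> t)) \<and> arc_of (if 0 < \<sigma> then Y else X) \<gamma> a b"

text \<open>The last zero of \<open>h\<close> before \<open>t\<close> and the first one after it
  bound the excursion. Both are crossings, and their directions are forced by the sign of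
  \<open>h\<close> in between.\<close>

lemma excursion_through:
  assumes loop: "crossing_loop X Y \<gamma> T" and cont: "continuous_on UNIV X" "continuous_on UNIV Y"
    and t: "t \<in> {0..T}" "\<sigma> = 1 \<or> \<sigma> = -1" "0 < \<sigma> * hfun (\<gamma> t)"
  obtains a b where "excursion X Y \<gamma> T \<sigma> a b" "a < t" "t < b"
proof -
  have sol: "filippov_solution X Y \<gamma> 0 T" and S1: "\<gamma> 0 \<in> S1" "\<gamma> T \<in> S1"
    and sub: "\<gamma> ` {0..T} \<inter> S1 \<subseteq> crossing_region X Y"
    using loop by (auto simp: crossing_loop_def)
  let ?f = "\<lambda>t. \<sigma> * hfun (\<gamma> t)"
  have f: "continuous_on {0..T} ?f"
    by (intro continuous_on_mult continuous_on_const continuous_on_hfun filippov_solution_continuous[OF sol])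
  obtain b where b: "t < b" "b \<le> T" "?f b = 0" "\<And>u. t \<le> u \<Longrightarrow> u < b \<Longrightarrow> 0 < ?f u"
    by (rule first_zero_right[of t T ?f])
       (use t S1 in \<open>auto simp: mem_S1_iff intro!: continuous_on_subset[OF f]\<close>)
  obtain a where a: "0 \<le> a" "a < t" "?f a = 0" "\<And>u. a < u \<Longrightarrow> u \<le> t \<Longrightarrow> 0 < ?f u"
    by (rule last_zero_left[of 0 t ?f])
       (use t S1 in \<open>auto simp: mem_S1_iff intro!: continuous_on_subset[OF f]\<close>)
  have pos: "0 < ?f u" if "a < u" "u < b" for u
    using a(4)[of u] b(4)[of u] that by (cases "u \<le> t") auto
  have "\<gamma> a \<in> crossing_region X Y" "\<gamma> b \<in> crossing_region X Y"
    using sub a b t by (auto simp: mem_S1_iff)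
  then obtain \<tau> \<upsilon> where \<tau>: "\<tau> = 1 \<or> \<tau> = -1" "crosses X Y \<tau> (\<gamma> a)"
    and \<upsilon>: "\<upsilon> = 1 \<or> \<upsilon> = -1" "crosses X Y \<upsilon> (\<gamma> b)"
    unfolding crossing_region_eq by blast
  have "\<tau> = \<sigma>"
  proof -
    obtain \<epsilon> where e: "\<epsilon> > 0" "\<And>t. t \<in> {0..T} \<Longrightarrow> a < t \<Longrightarrow> t < a + \<epsilon> \<Longrightarrow> 0 < \<tau> * hfun (\<gamma> t)"
      by (rule crosses_sign_change[OF \<tau>(2) cont sol, rotated]) (use a b t in auto)
    \<comment> \<open>\<open>u\<close> is close enough to \<open>a\<close> for the local sign rule
      and still inside the excursion, so both determine the sign of \<open>h\<close> there.\<close>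
    define u where "u = min (a + \<epsilon> / 2) t"
    have "a < u" "u < a + \<epsilon>" "u \<le> t" using a e(1) by (auto simp: u_def)
    then have "0 < \<tau> * hfun (\<gamma> u)" "0 < \<sigma> * hfun (\<gamma> u)"
      using e(2)[of u] pos[of u] a(1) b(1,2) by simp_all
    then show ?thesis using \<tau>(1) t(2) by auto
  qed
  moreover have "\<upsilon> = - \<sigma>"
  proof -
    obtain \<epsilon> where e: "\<epsilon> > 0" "\<And>t. t \<in> {0..T} \<Longrightarrow> t < b \<Longrightarrow> b - \<epsilon> < t \<Longrightarrow> \<upsilon> * hfun (\<gamma> t) < 0"
      by (rule crosses_sign_change[OF \<upsilon>(2) cont sol, rotated]) (use a b t in auto)
    define u where "u = max (b - \<epsilon> / 2) t"
    have "u < b" "b - \<epsilon> < u" "t \<le> u" using b e(1) by (auto simp: u_def)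
    then have "\<upsilon> * hfun (\<gamma> u) < 0" "0 < \<sigma> * hfun (\<gamma> u)"
      using e(2)[of u] pos[of u] a(1,2) b(1,2) by simp_all
    then show ?thesis using \<upsilon>(1) t(2) by auto
  qed
  moreover have "arc_of (if 0 < \<sigma> then Y else X) \<gamma> a b"
  proof (rule filippov_solution_arc_of)
    show "filippov_solution X Y \<gamma> a b"
      by (rule filippov_solution_subinterval[OF sol]) (use a b in auto)
    show "filippov_set X Y (\<gamma> u) = {(if 0 < \<sigma> then Y else X) (\<gamma> u)}" if "a < u" "u < b" for u
      using pos[OF that] t(2) by (auto simp: filippov_set_def)
  qed (use cont in auto)
  ultimately have "excursion X Y \<gamma> T \<sigma> a b"
    unfolding excursion_def using a b pos \<tau> \<upsilon> by auto
  then show thesis using that a(2) b(1) by blast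
qed

lemma excursion_from:
  assumes loop: "crossing_loop X Y \<gamma> T" and cont: "continuous_on UNIV X" "continuous_on UNIV Y"
    and z: "z \<in> \<gamma> ` {0..T}" "\<sigma> = 1 \<or> \<sigma> = -1" "crosses X Y \<sigma> z"
  obtains a b where "excursion X Y \<gamma> T \<sigma> a b" "\<gamma> a = z"
proof -
  have sol: "filippov_solution X Y \<gamma> 0 T" and T: "0 < T" "\<gamma> T = \<gamma> 0"
    using loop by (auto simp: crossing_loop_def)
  obtain s where s: "0 \<le> s" "s < T" "\<gamma> s = z"
    \<comment> \<open>The final time can be replaced by 0 because the loop closes up, so there is
      always room after \<open>s\<close>.\<close>
    using z(1) T by (metis atLeastAtMost_iff imageE less_eq_real_def order_refl)
  obtain \<epsilon> where e: "\<epsilon> > 0" "\<And>t. t \<in> {0..T} \<Longrightarrow> s < t \<Longrightarrow> t < s + \<epsilon> \<Longrightarrow> 0 < \<sigma> * hfun (\<gamma> t)"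
    by (rule crosses_sign_change[OF _ cont sol, of \<sigma> s, rotated 2]) (use z(3) s in auto)
  define t where "t = s + min \<epsilon> (T - s) / 2"
  have t: "t \<in> {0..T}" "s < t" "t < s + \<epsilon>" using s e(1) by (auto simp: t_def min_def field_simps)
  obtain a b where ab: "excursion X Y \<gamma> T \<sigma> a b" "a < t" "t < b"
    using excursion_through[OF loop cont t(1) z(2) e(2)[OF t]] .
  have "hfun (\<gamma> s) = 0" "hfun (\<gamma> a) = 0" "0 \<le> a" "b \<le> T"
    using z(3) s(3) ab(1) by (auto simp: crosses_def excursion_def mem_S1_iff)
  moreover have "0 < \<sigma> * hfun (\<gamma> s)" if "a < s"
    using that ab t unfolding excursion_def by auto
  moreover have "0 < \<sigma> * hfun (\<gamma> a)" if "s < a"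
    using e(2)[of a] that ab t \<open>0 \<le> a\<close> by auto
  \<comment> \<open>If \<open>a < s\<close>, then \<open>s\<close> would be interior to the
    excursion; if \<open>s < a\<close>, the local sign rule would apply at \<open>a\<close>. Either
    contradicts \<open>h = 0\<close> at that time.\<close>
  ultimately have "a = s" by (metis less_irrefl mult_zero_right not_less_iff_gr_or_eq)
  then show thesis using that ab(1) s(3) by blast
qed

lemma excursion_to:
  assumes loop: "crossing_loop X Y \<gamma> T" and cont: "continuous_on UNIV X" "continuous_on UNIV Y"
    and z: "z \<in> \<gamma> ` {0..T}" "\<sigma> = 1 \<or> \<sigma> = -1" "crosses X Y (-\<sigma>) z"
  obtains a b where "excursion X Y \<gamma> T \<sigma> a b" "\<gamma> b = z"
proof -
  have sol: "filippov_solution X Y \<gamma> 0 T" and T: "0 < T" "\<gamma> T = \<gamma> 0"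
    using loop by (auto simp: crossing_loop_def)
  obtain s where s: "0 < s" "s \<le> T" "\<gamma> s = z"
    using z(1) T by (metis atLeastAtMost_iff imageE less_eq_real_def order_refl)
  obtain \<epsilon> where e: "\<epsilon> > 0" "\<And>t. t \<in> {0..T} \<Longrightarrow> t < s \<Longrightarrow> s - \<epsilon> < t \<Longrightarrow> (-\<sigma>) * hfun (\<gamma> t) < 0"
    by (rule crosses_sign_change[OF _ cont sol, of "-\<sigma>" s, rotated 2]) (use z(3) s in auto)
  define t where "t = s - min \<epsilon> s / 2"
  have t: "t \<in> {0..T}" "t < s" "s - \<epsilon> < t" using s e(1) by (auto simp: t_def min_def field_simps)
  have "0 < \<sigma> * hfun (\<gamma> t)" using e(2)[OF t] by simp
  then obtain a b where ab: "excursion X Y \<gamma> T \<sigma> a b" "a < t" "t < b"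
    using excursion_through[OF loop cont t(1) z(2)] by blast
  have "hfun (\<gamma> s) = 0" "hfun (\<gamma> b) = 0" "0 \<le> a" "b \<le> T"
    using z(3) s(3) ab(1) by (auto simp: crosses_def excursion_def mem_S1_iff)
  moreover have "0 < \<sigma> * hfun (\<gamma> s)" if "s < b"
    using that ab t unfolding excursion_def by auto
  moreover have "0 < \<sigma> * hfun (\<gamma> b)" if "b < s"
    using e(2)[of b] that ab t \<open>0 \<le> a\<close> \<open>b \<le> T\<close> by auto
  ultimately have "b = s" by (metis less_irrefl mult_zero_right not_less_iff_gr_or_eq)
  then show thesis using that ab(1) s(3) by blast
qed

text \<open>The period is cut at \<open>s\<close> and the two pieces are exchanged;
  \<open>\<gamma> T = \<gamma> 0\<close> glues them at time \<open>T - s\<close>.\<close>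

lemma crossing_loop_rotate:
  assumes T: "0 < T" "\<gamma> T = \<gamma> 0" and sol: "filippov_solution X Y \<gamma> 0 T"
    and sub: "\<gamma> ` {0..T} \<inter> S1 \<subseteq> crossing_region X Y" and s: "s \<in> {0..T}" "\<gamma> s \<in> S1"
  obtains \<delta> where "crossing_loop X Y \<delta> T" "\<delta> ` {0..T} = \<gamma> ` {0..T}"
proof -
  define \<delta> where "\<delta> = (\<lambda>t. if t \<le> T - s then \<gamma> (t + s) else \<gamma> (t + (s - T)))"
  have "filippov_solution X Y \<delta> 0 (T - s)"
    by (rule filippov_solution_cong[OF filippov_solution_subinterval[OF filippov_solution_shift[OF sol, of s]]])
       (use s in \<open>auto simp: \<delta>_def\<close>)
  moreover have "filippov_solution X Y \<delta> (T - s) T"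
    by (rule filippov_solution_cong[OF filippov_solution_subinterval[OF filippov_solution_shift[OF sol, of "s - T"]]])
       (use s T in \<open>auto simp: \<delta>_def\<close>)
  ultimately have "filippov_solution X Y \<delta> 0 T"
    by (rule filippov_solution_join) (use s in auto)
  moreover have im: "\<delta> ` {0..T} = \<gamma> ` {0..T}"
  proof (intro equalityI subsetI)
    fix z assume "z \<in> \<delta> ` {0..T}"
    then obtain t where "t \<in> {0..T}" "z = \<delta> t" by blast
    then show "z \<in> \<gamma> ` {0..T}"
      using s by (auto simp: \<delta>_def intro!: imageI)
  next
    fix z assume "z \<in> \<gamma> ` {0..T}"
    then obtain t where t: "t \<in> {0..T}" "z = \<gamma> t" by blast
    show "z \<in> \<delta> ` {0..T}"
    proof (cases "s \<le> t")
      case True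
      then have "z = \<delta> (t - s)" "t - s \<in> {0..T}" using t s by (auto simp: \<delta>_def)
      then show ?thesis by blast
    next
      case False
      then have "z = \<delta> (t + T - s)" "t + T - s \<in> {0..T}" using t s T by (auto simp: \<delta>_def)
      then show ?thesis by blast
    qed
  qed
  moreover have "\<delta> T = \<delta> 0" "\<delta> 0 \<in> S1" using s T by (auto simp: \<delta>_def)
  ultimately have "crossing_loop X Y \<delta> T"
    using T sub by (simp add: crossing_loop_def)
  then show thesis using that im by blast
qed

section \<open>First integrals and uniqueness of trajectories\<close>

definition first_integral :: "(plane \<Rightarrow> real) \<Rightarrow> vfield \<Rightarrow> bool" where
  "first_integral H W \<longleftrightarrow> (\<forall>z. \<exists>D. (H has_derivative D) (at z) \<and> D (W z) = 0)"

lemma first_integral_arc: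
  assumes "first_integral H W" "arc_of W \<gamma> a b" "t \<in> {a..b}"
  shows "H (\<gamma> t) = H (\<gamma> a)"
proof -
  have d: "((\<lambda>t. H (\<gamma> t)) has_vector_derivative 0) (at u within {a..b})" if "u \<in> {a..b}" for u
  proof -
    have g: "(\<gamma> has_derivative (\<lambda>x. x *\<^sub>R W (\<gamma> u))) (at u within {a..b})"
      using assms(2) that by (simp add: arc_of_def has_vector_derivative_def)
    obtain D where D: "(H has_derivative D) (at (\<gamma> u))" "D (W (\<gamma> u)) = 0"
      using assms(1) unfolding first_integral_def by blast
    have "((\<lambda>t. H (\<gamma> t)) has_derivative (\<lambda>x. D (x *\<^sub>R W (\<gamma> u)))) (at u within {a..b})"
      by (rule has_derivative_compose[OF g D(1)])
    moreover have "D (x *\<^sub>R W (\<gamma> u)) = x *\<^sub>R 0" for x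
      using linear_scale[OF has_derivative_linear[OF D(1)]] D(2) by simp
    ultimately show ?thesis by (simp add: has_vector_derivative_def)
  qed
  have "\<exists>c. \<forall>u\<in>{a..b}. H (\<gamma> u) = c"
    by (rule has_vector_derivative_zero_constant[OF convex_real_interval(5) d]) auto
  then show ?thesis using assms(3) by auto
qed

lemma arc_of_subset:
  assumes "arc_of W \<gamma> a b" "a \<le> c" "d \<le> b"
  shows "arc_of W \<gamma> c d"
  unfolding arc_of_def
proof
  fix t assume "t \<in> {c..d}"
  then show "(\<gamma> has_vector_derivative W (\<gamma> t)) (at t within {c..d})"
    using assms unfolding arc_of_def
    by (intro has_vector_derivative_within_subset[where S = "{a..b}" and T = "{c..d}"]) auto
qed

lemma arc_of_shift:
  assumes "arc_of W \<gamma> a b"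
  shows "arc_of W (\<lambda>t. \<gamma> (t + s)) (a - s) (b - s)"
  unfolding arc_of_def
proof
  fix t assume "t \<in> {a - s..b - s}"
  then have "(\<gamma> has_vector_derivative W (\<gamma> (t + s))) (at (t + s) within {a..b})"
    using assms by (auto simp: arc_of_def)
  moreover have "(\<lambda>t. t + s) ` {a - s..b - s} = {a..b}" by simp
  ultimately have "(\<gamma> has_derivative (\<lambda>x. x *\<^sub>R W (\<gamma> (t + s)))) (at (t + s) within (\<lambda>t. t + s) ` {a - s..b - s})"
    by (simp add: has_vector_derivative_def)
  moreover have "((\<lambda>t. t + s) has_derivative (\<lambda>x. x)) (at t within {a - s..b - s})"
    by (auto intro!: derivative_eq_intros)
  ultimately show "((\<lambda>t. \<gamma> (t + s)) has_vector_derivative W (\<gamma> (t + s))) (at t within {a - s..b - s})"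
    unfolding has_vector_derivative_def
    using has_derivative_in_compose[of "\<lambda>t. t + s" "\<lambda>x. x" t "{a - s..b - s}" \<gamma>] by blast
qed

text \<open>Gronwall's argument: the Lipschitz bound makes \<open>exp (- 2 * L * t)\<close> times
  the squared distance of the two curves nonincreasing, and it starts at 0.\<close>

lemma arc_of_unique:
  assumes "L-lipschitz_on UNIV W" "arc_of W \<gamma> a b" "arc_of W \<delta> a b" "\<gamma> a = \<delta> a" "t \<in> {a..b}"
  shows "\<gamma> t = \<delta> t"
proof -
  define g where "g = (\<lambda>t. exp (- 2 * L * t) * ((\<gamma> t - \<delta> t) \<bullet> (\<gamma> t - \<delta> t)))"
  have der: "(g has_vector_derivative
      exp (- 2 * L * u) * (2 * ((\<gamma> u - \<delta> u) \<bullet> (W (\<gamma> u) - W (\<delta> u))) - 2 * L * ((\<gamma> u - \<delta> u) \<bullet> (\<gamma> u - \<delta> u))))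
      (at u within {a..b})" if "u \<in> {a..b}" for u
  proof -
    have g: "(\<gamma> has_derivative (\<lambda>x. x *\<^sub>R W (\<gamma> u))) (at u within {a..b})"
      "(\<delta> has_derivative (\<lambda>x. x *\<^sub>R W (\<delta> u))) (at u within {a..b})"
      using assms(2,3) that by (simp_all add: arc_of_def has_vector_derivative_def)
    show ?thesis
      unfolding g_def has_vector_derivative_def
      by (rule derivative_eq_intros g refl | simp)+
         (simp add: fun_eq_iff algebra_simps inner_commute)
  qed
  have nonpos: "exp (- 2 * L * u) * (2 * ((\<gamma> u - \<delta> u) \<bullet> (W (\<gamma> u) - W (\<delta> u))) - 2 * L * ((\<gamma> u - \<delta> u) \<bullet> (\<gamma> u - \<delta> u))) \<le> 0" for u
  proof -
    have "(\<gamma> u - \<delta> u) \<bullet> (W (\<gamma> u) - W (\<delta> u)) \<le> norm (\<gamma> u - \<delta> u) * norm (W (\<gamma> u) - W (\<delta> u))"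
      by (rule norm_cauchy_schwarz)
    also have "\<dots> \<le> norm (\<gamma> u - \<delta> u) * (L * norm (\<gamma> u - \<delta> u))"
      using lipschitz_onD[OF assms(1)] by (intro mult_left_mono) (auto simp: dist_norm)
    also have "\<dots> = L * ((\<gamma> u - \<delta> u) \<bullet> (\<gamma> u - \<delta> u))"
      by (simp add: dot_square_norm power2_eq_square)
    finally show ?thesis by (intro mult_nonneg_nonpos) auto
  qed
  have "g t \<le> g a"
  proof (rule DERIV_nonpos_imp_decreasing_open[of a t g])
    show "a \<le> t" using assms(5) by auto
    show "\<exists>y. (g has_real_derivative y) (at u) \<and> y \<le> 0" if "a < u" "u < t" for u
    proof -
      have "at u within {a..b} = at u" using that assms(5) by (intro at_within_Icc_at) auto
      then show ?thesis
        using der[of u] nonpos[of u] that assms(5) 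
        by (intro exI conjI nonpos[of u]) (auto simp: has_real_derivative_iff_has_vector_derivative)
    qed
    show "continuous_on {a..t} g"
      by (rule continuous_on_subset[OF continuous_on_vector_derivative[OF der]]) (use assms(5) in auto)
  qed
  then have "(\<gamma> t - \<delta> t) \<bullet> (\<gamma> t - \<delta> t) \<le> 0"
    using assms(4) by (simp add: g_def mult_le_0_iff del: inner_diff_left inner_diff_right)
  then have "\<gamma> t - \<delta> t = 0" using inner_gt_zero_iff[of "\<gamma> t - \<delta> t"] by linarith
  then show ?thesis by simp
qed

lemma crosses_opposite: "crosses X Y \<sigma> z \<Longrightarrow> crosses X Y (- \<sigma>) z \<Longrightarrow> False"
  by (simp add: crosses_def)

text \<open>Shifted to start at time 0, the two excursions agree as long as both last. The first
  cannot outlast the second, which ends on the circle while an excursion stays off it in its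
  interior.\<close>

lemma excursion_subset:
  assumes lip: "L-lipschitz_on UNIV X" "M-lipschitz_on UNIV Y"
    and exc: "excursion X Y \<gamma> T \<sigma> a b" "excursion X Y \<delta> S \<sigma> c d"
    and "\<gamma> a = \<delta> c" "t \<in> {a..b}"
  shows "\<gamma> t \<in> \<delta> ` {0..S}"
proof -
  define W where "W = (if 0 < \<sigma> then Y else X)"
  obtain K where K: "K-lipschitz_on UNIV W" using lip by (cases "0 < \<sigma>") (auto simp: W_def)
  have ab: "a < b" "\<And>t. a < t \<Longrightarrow> t < b \<Longrightarrow> 0 < \<sigma> * hfun (\<gamma> t)" "arc_of W \<gamma> a b"
    and cd: "0 \<le> c" "c < d" "d \<le> S" "crosses X Y (- \<sigma>) (\<delta> d)" "arc_of W \<delta> c d"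
    using exc by (auto simp: excursion_def W_def)
  have arc: "arc_of W (\<lambda>t. \<gamma> (t + a)) 0 (b - a)" "arc_of W (\<lambda>t. \<delta> (t + c)) 0 (d - c)"
    using arc_of_shift[OF ab(3), of a] arc_of_shift[OF cd(5), of c] by simp_all
  define \<tau> where "\<tau> = min (b - a) (d - c)"
  have eq: "\<gamma> (u + a) = \<delta> (u + c)" if "u \<in> {0..\<tau>}" for u
    by (rule arc_of_unique[OF K arc_of_subset[OF arc(1), of 0 \<tau>] arc_of_subset[OF arc(2), of 0 \<tau>], of u])
       (use assms(5) that in \<open>auto simp: \<tau>_def\<close>)
  have "b - a \<le> d - c"
  proof (rule ccontr)
    assume *: "\<not> b - a \<le> d - c"
    then have "\<gamma> (d - c + a) = \<delta> d" using eq[of "d - c"] cd(2) by (simp add: \<tau>_def)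
    moreover have "0 < \<sigma> * hfun (\<gamma> (d - c + a))" using ab(2)[of "d - c + a"] cd(2) * by simp
    ultimately show False using cd(4) by (simp add: crosses_def mem_S1_iff)
  qed
  then have "\<gamma> t = \<delta> (t - a + c)" "t - a + c \<in> {0..S}"
    using eq[of "t - a"] assms(6) cd by (auto simp: \<tau>_def)
  then show ?thesis by simp
qed

section \<open>Loops are determined by their crossing points\<close>

lemma crossing_loop_crosses:
  assumes "crossing_loop X Y \<gamma> T" "z \<in> \<gamma> ` {0..T}" "z \<in> S1"
  obtains \<sigma> where "\<sigma> = 1 \<or> \<sigma> = -1" "crosses X Y \<sigma> z"
  using assms unfolding crossing_loop_def crossing_region_eq by blast

text \<open>A point off the circle lies on an excursion; the start of that excursion also belongs to
  the other loop, and the excursion leaving from there retraces the same arc. Orbits can thus be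
  compared through their circle points only.\<close>

lemma crossing_loop_subset:
  assumes lip: "L-lipschitz_on UNIV X" "M-lipschitz_on UNIV Y"
    and loop: "crossing_loop X Y \<gamma> T" "crossing_loop X Y \<delta> S"
    and sub: "\<gamma> ` {0..T} \<inter> S1 \<subseteq> \<delta> ` {0..S}"
  shows "\<gamma> ` {0..T} \<subseteq> \<delta> ` {0..S}"
proof
  note cont = lipschitz_on_continuous_on[OF lip(1)] lipschitz_on_continuous_on[OF lip(2)]
  fix z assume "z \<in> \<gamma> ` {0..T}"
  then obtain t where t: "t \<in> {0..T}" "z = \<gamma> t" by blast
  show "z \<in> \<delta> ` {0..S}"
  proof (cases "z \<in> S1")
    case True
    then show ?thesis using sub t by blast
  next
    case False
    define \<sigma> where "\<sigma> = sgn (hfun z)"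
    have \<sigma>: "\<sigma> = 1 \<or> \<sigma> = -1" "0 < \<sigma> * hfun (\<gamma> t)"
      using False t(2) by (auto simp: \<sigma>_def mem_S1_iff sgn_if)
    obtain a b where ab: "excursion X Y \<gamma> T \<sigma> a b" "a < t" "t < b"
      by (rule excursion_through[OF loop(1) cont t(1) \<sigma>])
    have cr: "crosses X Y \<sigma> (\<gamma> a)" using ab(1) by (simp add: excursion_def)
    moreover have "a \<in> {0..T}" using ab(1) by (simp add: excursion_def)
    ultimately have "\<gamma> a \<in> \<delta> ` {0..S}" using sub by (auto simp: crosses_def)
    then obtain c d where cd: "excursion X Y \<delta> S \<sigma> c d" "\<delta> c = \<gamma> a"
      by (rule excursion_from[OF loop(2) cont _ \<sigma>(1) cr])
    show ?thesis
      unfolding t(2) by (rule excursion_subset[OF lip ab(1) cd(1)]) (use cd(2) ab in auto)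
  qed
qed

lemma crossing_loop_image_eq:
  assumes "L-lipschitz_on UNIV X" "M-lipschitz_on UNIV Y"
    "crossing_loop X Y \<gamma> T" "crossing_loop X Y \<delta> S"
    "\<gamma> ` {0..T} \<inter> S1 = \<delta> ` {0..S} \<inter> S1"
  shows "\<gamma> ` {0..T} = \<delta> ` {0..S}"
  using crossing_loop_subset[OF assms(1-4)] crossing_loop_subset[OF assms(1,2,4,3)] assms(5) by blast

lemma excursion_points:
  assumes "excursion X Y \<gamma> T \<sigma> a b"
  shows "\<gamma> a \<in> \<gamma> ` {0..T}" "\<gamma> b \<in> \<gamma> ` {0..T}" "crosses X Y \<sigma> (\<gamma> a)" "crosses X Y (- \<sigma>) (\<gamma> b)"
    "\<gamma> a \<in> S1" "\<gamma> b \<in> S1"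
  using assms by (auto simp: excursion_def crosses_def)

lemma excursion_first_integral:
  assumes "first_integral HX X" "first_integral HY Y" "excursion X Y \<gamma> T \<sigma> a b"
  shows "0 < \<sigma> \<Longrightarrow> HY (\<gamma> b) = HY (\<gamma> a)" "\<sigma> < 0 \<Longrightarrow> HX (\<gamma> b) = HX (\<gamma> a)"
  using assms(3) first_integral_arc[OF assms(1), of \<gamma> a b b] first_integral_arc[OF assms(2), of \<gamma> a b b]
  by (auto simp: excursion_def)

text \<open>An excursion ends with the direction opposite to the one it starts with. With only two
  circle points, the outer excursion from \<open>p\<close> ends at \<open>q\<close> and the inner
  one from \<open>q\<close> returns to \<open>p\<close>, so each first integral agrees at the two
  points.\<close>

lemma two_point_loop:
  assumes cont: "continuous_on UNIV X" "continuous_on UNIV Y"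
    and int: "first_integral HX X" "first_integral HY Y"
    and loop: "crossing_loop X Y \<gamma> T" and card: "card (\<gamma> ` {0..T} \<inter> S1) = 2"
  obtains p q where "\<gamma> ` {0..T} \<inter> S1 = {p, q}" "p \<noteq> q" "crosses X Y 1 p" "crosses X Y (-1) q"
    "HX p = HX q" "HY p = HY q"
proof -
  obtain x y where xy: "\<gamma> ` {0..T} \<inter> S1 = {x, y}" "x \<noteq> y"
    using card by (metis card_2_iff)
  have "\<exists>p\<in>\<gamma> ` {0..T}. crosses X Y 1 p"
  proof -
    obtain \<sigma> where \<sigma>: "\<sigma> = 1 \<or> \<sigma> = -1" "crosses X Y \<sigma> x"
      by (rule crossing_loop_crosses[OF loop, where z = x]) (use xy(1) in auto)
    show ?thesis
    proof (cases "\<sigma> = 1")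
      case True
      then show ?thesis using \<sigma>(2) xy(1) by blast
    next
      case False
      then have m: "\<sigma> = -1" using \<sigma>(1) by simp
      obtain a b where "excursion X Y \<gamma> T \<sigma> a b"
        by (rule excursion_from[OF loop cont _ \<sigma>]) (use xy(1) in auto)
      then show ?thesis using excursion_points(2,4)[of X Y \<gamma> T \<sigma> a b] m by auto
    qed
  qed
  then obtain p where p: "p \<in> \<gamma> ` {0..T}" "crosses X Y 1 p" by blast
  obtain a b where ab: "excursion X Y \<gamma> T 1 a b" "\<gamma> a = p"
    by (rule excursion_from[OF loop cont p(1) _ p(2)]) auto
  define q where "q = \<gamma> b"
  have q: "q \<in> \<gamma> ` {0..T}" "crosses X Y (-1) q"
    using excursion_points[OF ab(1)] by (simp_all add: q_def)
  obtain c d where cd: "excursion X Y \<gamma> T (-1) c d" "\<gamma> c = q"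
    by (rule excursion_from[OF loop cont q(1) _ q(2)]) auto
  have d: "\<gamma> d \<in> \<gamma> ` {0..T}" "crosses X Y 1 (\<gamma> d)"
    using excursion_points[OF cd(1)] by simp_all
  have "p \<noteq> q" using crosses_opposite[of X Y 1 p] p q by auto
  moreover have "\<gamma> d \<noteq> q" using crosses_opposite[of X Y 1 q] d q by auto
  moreover have "p \<in> {x, y}" "q \<in> {x, y}" "\<gamma> d \<in> {x, y}"
    using p q d xy(1) by (auto simp: crosses_def)
  ultimately have "{x, y} = {p, q}" "\<gamma> d = p" by auto
  then show thesis
    using that[of p q] xy(1) \<open>p \<noteq> q\<close> p(2) q(2) ab(2) cd(2) q_def
      excursion_first_integral(1)[OF int ab(1)] excursion_first_integral(2)[OF int cd(1)] by simp
qed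

text \<open>\<open>P\<close> and \<open>Q\<close> stand for short pieces of the circle around
  \<open>p\<close> and \<open>q\<close>. No return map is constructed: the excursions leaving and
  reaching a crossing provide its images and preimages. No bound on the number of crossings is
  assumed; compactness supplies the extremal ones.\<close>

lemma isolated_loop:
  assumes cont: "continuous_on UNIV X" "continuous_on UNIV Y"
    and int: "first_integral HX X" "first_integral HY Y"
    and loop: "crossing_loop X Y \<gamma> T" and sub: "\<gamma> ` {0..T} \<inter> S1 \<subseteq> P \<union> Q"
    and P: "\<And>z. z \<in> P \<Longrightarrow> crosses X Y 1 z" and Q: "\<And>z. z \<in> Q \<Longrightarrow> crosses X Y (-1) z"
    and monoP: "\<And>z w. z \<in> P \<Longrightarrow> w \<in> P \<Longrightarrow> HX z \<le> HX w \<longleftrightarrow> HY z \<le> HY w"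
    and monoQ: "\<And>z w. z \<in> Q \<Longrightarrow> w \<in> Q \<Longrightarrow> HX z \<le> HX w \<longleftrightarrow> HY z \<le> HY w"
    and inj: "inj_on HY P" "inj_on HY Q"
    and uniq: "\<And>z w. z \<in> P \<Longrightarrow> w \<in> Q \<Longrightarrow> HX z = HX w \<Longrightarrow> HY z = HY w \<Longrightarrow> z = p \<and> w = q"
  shows "\<gamma> ` {0..T} \<inter> S1 = {p, q}"
proof -
  let ?I = "\<gamma> ` {0..T}"
  have inP: "z \<in> P" if "z \<in> ?I" "crosses X Y 1 z" for z
  proof -
    have "z \<notin> Q" using Q[of z] crosses_opposite[of X Y 1 z] that(2) by auto
    then show ?thesis using sub that by (auto simp: crosses_def)
  qed
  have inQ: "z \<in> Q" if "z \<in> ?I" "crosses X Y (-1) z" for z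
  proof -
    have "z \<notin> P" using P[of z] crosses_opposite[of X Y 1 z] that(2) by auto
    then show ?thesis using sub that by (auto simp: crosses_def)
  qed
  have outward: "\<exists>w\<in>?I \<inter> Q. HY w = HY z" if z: "z \<in> ?I" "z \<in> P" for z
  proof -
    obtain a b where ab: "excursion X Y \<gamma> T 1 a b" "\<gamma> a = z"
      by (rule excursion_from[OF loop cont z(1) _ P[OF z(2)]]) auto
    then show ?thesis
      using excursion_points[OF ab(1)] excursion_first_integral(1)[OF int ab(1)] inQ by auto
  qed
  have inward: "\<exists>z\<in>?I \<inter> P. HX z = HX w" if w: "w \<in> ?I" "w \<in> Q" for w
  proof -
    obtain a b where ab: "excursion X Y \<gamma> T (-1) a b" "\<gamma> a = w"
      by (rule excursion_from[OF loop cont w(1) _ Q[OF w(2)]]) auto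
    then show ?thesis
      using excursion_points[OF ab(1)] excursion_first_integral(2)[OF int ab(1)] inP by auto
  qed
  have pre_outward: "\<exists>z\<in>?I \<inter> P. HY z = HY w" if w: "w \<in> ?I" "w \<in> Q" for w
  proof -
    obtain a b where ab: "excursion X Y \<gamma> T 1 a b" "\<gamma> b = w"
      by (rule excursion_to[OF loop cont w(1) _ Q[OF w(2)]]) auto
    then show ?thesis
      using excursion_points[OF ab(1)] excursion_first_integral(1)[OF int ab(1)] inP by auto
  qed
  have pre_inward: "\<exists>w\<in>?I \<inter> Q. HX w = HX z" if z: "z \<in> ?I" "z \<in> P" for z
  proof -
    obtain a b where ab: "excursion X Y \<gamma> T (-1) a b" "\<gamma> b = z"
      by (rule excursion_to[OF loop cont z(1), of "-1"]) (use P[OF z(2)] in auto)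
    then show ?thesis
      using excursion_points[OF ab(1)] excursion_first_integral(2)[OF int ab(1)] inQ by auto
  qed
  text \<open>The return map preserves the order given by \<open>HY\<close>, so its extremal points are fixed.\<close>
  have extremal: "z = p \<and> q \<in> ?I"
    if z: "z \<in> ?I \<inter> P" and s: "s = 1 \<or> s = -1" and ext: "\<And>x. x \<in> ?I \<inter> P \<Longrightarrow> s * HY x \<le> s * HY z" for z s
  proof -
    \<comment> \<open>\<open>w\<close> and \<open>z2\<close> follow \<open>z\<close>, while
      \<open>w'\<close> and \<open>z'\<close> precede it. Extremality against \<open>z'\<close>
      gives \<open>s * HX z \<le> s * HX z2\<close>, against \<open>z2\<close> the reverse; equality
      makes \<open>z\<close> and \<open>w\<close> a solution of both equations. The choice
      \<open>s = -1\<close> covers minima.\<close>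
    obtain w where w: "w \<in> ?I \<inter> Q" "HY w = HY z" using outward z by blast
    obtain z2 where z2: "z2 \<in> ?I \<inter> P" "HX z2 = HX w" using inward w by blast
    obtain w' where w': "w' \<in> ?I \<inter> Q" "HX w' = HX z" using pre_inward z by blast
    obtain z' where z': "z' \<in> ?I \<inter> P" "HY z' = HY w'" using pre_outward w' by blast
    have mP: "s * HX x \<le> s * HX y \<longleftrightarrow> s * HY x \<le> s * HY y" if "x \<in> P" "y \<in> P" for x y
      using monoP that s by auto
    have mQ: "s * HX x \<le> s * HX y \<longleftrightarrow> s * HY x \<le> s * HY y" if "x \<in> Q" "y \<in> Q" for x y
      using monoQ that s by auto
    have "s * HX w' \<le> s * HX w" using mQ[of w' w] ext[OF z'(1)] w w' z' by simp
    then have "s * HX z \<le> s * HX z2" using w' z2 by simp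
    moreover have "s * HX z2 \<le> s * HX z" using mP[of z2 z] ext[OF z2(1)] z z2 by simp
    ultimately have "HX z = HX w" using s z2(2) by auto
    then show ?thesis using uniq[of z w] z w by auto
  qed
  \<comment> \<open>\<open>P\<close> need not be closed; the sign of \<open>X z \<bullet> z\<close>
    separates it from \<open>Q\<close> by a closed condition, which makes the set of outward
    crossings compact.\<close>
  define Pout where "Pout = {z \<in> ?I. hfun z = 0 \<and> 0 \<le> X z \<bullet> z}"
  have Pout: "Pout = ?I \<inter> P"
  proof (intro equalityI subsetI)
    fix z assume "z \<in> Pout"
    then have z: "z \<in> ?I" "z \<in> S1" "0 \<le> X z \<bullet> z" by (auto simp: Pout_def mem_S1_iff)
    then have "z \<notin> Q" using Q[of z] by (auto simp: crosses_def)
    then show "z \<in> ?I \<inter> P" using sub z by blast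
  next
    fix z assume "z \<in> ?I \<inter> P"
    then show "z \<in> Pout" using P[of z] by (auto simp: Pout_def crosses_def mem_S1_iff)
  qed
  have compact: "compact Pout"
  proof -
    have "compact ?I"
      by (rule compact_continuous_image[OF filippov_solution_continuous compact_Icc])
         (use loop in \<open>auto simp: crossing_loop_def\<close>)
    moreover have "closed {z. hfun z = 0 \<and> 0 \<le> X z \<bullet> z}"
      by (intro closed_Collect_conj closed_Collect_eq closed_Collect_le continuous_on_hfun
          continuous_intros cont)
    moreover have "Pout = ?I \<inter> {z. hfun z = 0 \<and> 0 \<le> X z \<bullet> z}" by (auto simp: Pout_def)
    ultimately show ?thesis by (simp add: compact_Int_closed)
  qed
  have contHY: "continuous_on Pout HY"
  proof -
    have "isCont HY z" for z
      using int(2) unfolding first_integral_def by (metis has_derivative_continuous)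
    then show ?thesis by (simp add: continuous_at_imp_continuous_on)
  qed
  have ne: "Pout \<noteq> {}"
  proof -
    have "\<gamma> 0 \<in> ?I" "\<gamma> 0 \<in> S1" using loop by (auto simp: crossing_loop_def)
    then show ?thesis using sub inward[of "\<gamma> 0"] Pout by blast
  qed
  obtain zM where zM: "zM \<in> Pout" "\<forall>z\<in>Pout. HY z \<le> HY zM"
    using continuous_attains_sup[OF compact ne contHY] by blast
  obtain zm where zm: "zm \<in> Pout" "\<forall>z\<in>Pout. HY zm \<le> HY z"
    using continuous_attains_inf[OF compact ne contHY] by blast
  have M: "zM = p" "q \<in> ?I" using extremal[of zM 1] zM Pout by auto
  have m: "zm = p" using extremal[of zm "-1"] zm Pout by auto
  have onlyp: "z = p" if "z \<in> ?I \<inter> P" for z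
  proof -
    \<comment> \<open>Maximum and minimum of \<open>HY\<close> over the outward crossings are both
      attained at \<open>p\<close>.\<close>
    have "HY z = HY p" using that zM(2) zm(2) M(1) m Pout by (intro antisym) auto
    then show ?thesis using inj_onD[OF inj(1)] that zM(1) M(1) Pout by blast
  qed
  have HYq: "HY q = HY p" "q \<in> Q"
  proof -
    obtain w where w: "w \<in> ?I \<inter> Q" "HY w = HY p" using outward[of p] zM(1) M(1) Pout by blast
    obtain z where z: "z \<in> ?I \<inter> P" "HX z = HX w" using inward[of w] w by blast
    then have "z = p" by (intro onlyp)
    then have "w = q" using uniq[of p w] z w by auto
    then show "HY q = HY p" "q \<in> Q" using w by auto
  qed
  have onlyq: "w = q" if w: "w \<in> ?I \<inter> Q" for w
  proof -
    obtain z where "z \<in> ?I \<inter> P" "HY z = HY w" using pre_outward w by blast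
    then have "HY w = HY q" using onlyp HYq(1) by metis
    then show ?thesis using inj_onD[OF inj(2)] w HYq(2) by blast
  qed
  have "p \<in> ?I \<inter> P" using zM(1) M(1) Pout by simp
  then have "{p, q} \<subseteq> ?I \<inter> S1"
    using M(2) P[of p] Q[of q] HYq(2) by (auto simp: crosses_def)
  moreover have "?I \<inter> S1 \<subseteq> {p, q}" using sub onlyp onlyq by blast
  ultimately show ?thesis by blast
qed

section \<open>Affine Hamiltonian fields\<close>

text \<open>The Hamiltonian for the sign convention \<open>x' = - dH/dy\<close>,
  \<open>y' = dH/dx\<close>; the associated \<open>ham_field\<close> is the general affine field of
  trace 0.\<close>

definition ham :: "real \<Rightarrow> real \<Rightarrow> real \<Rightarrow> real \<Rightarrow> real \<Rightarrow> plane \<Rightarrow> real" where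
  "ham a b c e f z = c / 2 * (z $ 1)\<^sup>2 - a * z $ 1 * z $ 2 - b / 2 * (z $ 2)\<^sup>2 + f * z $ 1 - e * z $ 2"

definition ham_field :: "real \<Rightarrow> real \<Rightarrow> real \<Rightarrow> real \<Rightarrow> real \<Rightarrow> vfield" where
  "ham_field a b c e f z = vector [a * z $ 1 + b * z $ 2 + e, c * z $ 1 - a * z $ 2 + f]"

lemma ham_field_affine:
  "ham_field a b c e f = (\<lambda>z. vector [vector [a, b], vector [c, - a]] *v z + vector [e, f])"
  by (simp add: fun_eq_iff vec_eq_iff forall_2 ham_field_def matrix_vector_mult_def sum_2)

lemma first_integral_ham: "first_integral (ham a b c e f) (ham_field a b c e f)"
  unfolding first_integral_def
proof
  fix z :: plane
  let ?D = "\<lambda>w :: plane. (c * z $ 1 - a * z $ 2 + f) * w $ 1 - (a * z $ 1 + b * z $ 2 + e) * w $ 2"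
  have "(ham a b c e f has_derivative ?D) (at z)"
    unfolding ham_def[abs_def]
    by (auto intro!: derivative_eq_intros bounded_linear.has_derivative[OF bounded_linear_vec_nth]
        simp: algebra_simps)
  then show "\<exists>D. (ham a b c e f has_derivative D) (at z) \<and> D (ham_field a b c e f z) = 0"
    by (intro exI[of _ ?D] conjI) (simp_all add: ham_field_def)
qed

lemma lipschitz_ham_field: "\<exists>L. L-lipschitz_on UNIV (ham_field a b c e f)"
proof -
  let ?A = "vector [vector [a, b], vector [c, - a]] :: real ^ 2 ^ 2"
  obtain K where K: "0 < K" "\<And>z. norm (?A *v z) \<le> norm z * K"
    using bounded_linear.pos_bounded[OF matrix_vector_mul_bounded_linear[of ?A]] by blast
  have "K-lipschitz_on UNIV (ham_field a b c e f)"
    unfolding ham_field_affine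
    by (rule lipschitz_onI)
       (use K in \<open>simp_all add: dist_norm matrix_vector_mult_diff_distrib[symmetric] mult.commute\<close>)
  then show ?thesis ..
qed

section \<open>Divergence and spectrum of trace-free affine fields\<close>

lemma divergence_ham_field: "divergence (ham_field a b c e f) z = 0"
proof -
  let ?A = "vector [vector [a, b], vector [c, - a]] :: real ^ 2 ^ 2"
  have "(ham_field a b c e f has_derivative (*v) ?A) (at z)"
    unfolding ham_field_affine
    using has_derivative_add_const[OF bounded_linear_imp_has_derivative[OF matrix_vector_mul_bounded_linear[of ?A]]]
    by blast
  then have "jacobian (ham_field a b c e f) (at z) = ?A"
    unfolding jacobian_def by (metis frechet_derivative_at matrix_of_matrix_vector_mul)
  then show ?thesis by (simp add: divergence_def trace_def sum_2)
qed

text \<open>With trace 0 the characteristic polynomial is \<open>k^2 + det A\<close>, where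
  \<open>det A = - (a^2 + b * c)\<close>. The sign of \<open>a^2 + b * c\<close> then separates
  saddles from centers.\<close>

lemma eigenvalues_trace_free:
  "eigenvalues (vector [vector [a, b], vector [c, - a]]) = {k. k\<^sup>2 = complex_of_real (a\<^sup>2 + b * c)}"
proof -
  have eq: "(\<chi> i j. complex_of_real ((vector [vector [a, b], vector [c, - a]] :: real ^ 2 ^ 2) $ i $ j)) *v v = k *s v
    \<longleftrightarrow> (of_real a - k) * v $ 1 + of_real b * v $ 2 = 0 \<and> of_real c * v $ 1 - (of_real a + k) * v $ 2 = 0" for k :: complex and v :: "complex ^ 2"
    by (auto simp: vec_eq_iff forall_2 matrix_vector_mult_def sum_2 algebra_simps)
  have "(\<exists>v :: complex ^ 2. v \<noteq> 0 \<and> (of_real a - k) * v $ 1 + of_real b * v $ 2 = 0 \<and> of_real c * v $ 1 - (of_real a + k) * v $ 2 = 0)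
    \<longleftrightarrow> k\<^sup>2 = complex_of_real (a\<^sup>2 + b * c)" (is "(\<exists>v. ?P v) \<longleftrightarrow> _") for k :: complex
  proof
    assume "\<exists>v. ?P v"
    then obtain v where v: "?P v" by blast
    \<comment> \<open>The coefficients are the rows of the adjugate of \<open>A - k I\<close>, so
      the combinations of the two eigenvector equations yield \<open>det (A - k I)\<close> times
      \<open>v\<close>.\<close>
    have "(k\<^sup>2 - complex_of_real (a\<^sup>2 + b * c)) * v $ 1 = - (of_real a + k) * ((of_real a - k) * v $ 1 + of_real b * v $ 2)
        - of_real b * (of_real c * v $ 1 - (of_real a + k) * v $ 2)"
      by (simp add: algebra_simps power2_eq_square)
    moreover have "(k\<^sup>2 - complex_of_real (a\<^sup>2 + b * c)) * v $ 2 =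
        (of_real a - k) * (of_real c * v $ 1 - (of_real a + k) * v $ 2) - of_real c * ((of_real a - k) * v $ 1 + of_real b * v $ 2)"
      by (simp add: algebra_simps power2_eq_square)
    moreover have "v $ 1 \<noteq> 0 \<or> v $ 2 \<noteq> 0" using v by (simp add: vec_eq_iff forall_2)
    ultimately show "k\<^sup>2 = complex_of_real (a\<^sup>2 + b * c)" using v by auto
  next
    assume k: "k\<^sup>2 = complex_of_real (a\<^sup>2 + b * c)"
    \<comment> \<open>The candidates are the columns of \<open>A + k I\<close>, which
      \<open>A - k I\<close> annihilates because \<open>A^2 = k^2 I\<close>. Both vanish only for
      \<open>A = 0\<close> and \<open>k = 0\<close>, where any nonzero vector will do.\<close>
    consider "complex_of_real b \<noteq> 0 \<or> k \<noteq> of_real a" | "k + a \<noteq> 0 \<or> complex_of_real c \<noteq> 0"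
      | "complex_of_real b = 0" "complex_of_real c = 0" "k = of_real a" "k + a = 0" by blast
    then show "\<exists>v. ?P v"
    proof cases
      case 1
      then show ?thesis using k
        by (intro exI[of _ "vector [complex_of_real b, k - a]"])
           (auto simp: vec_eq_iff forall_2 algebra_simps power2_eq_square)
    next
      case 2
      then show ?thesis using k
        by (intro exI[of _ "vector [k + a, complex_of_real c]"])
           (auto simp: vec_eq_iff forall_2 algebra_simps power2_eq_square)
    next
      case 3
      then show ?thesis
        by (intro exI[of _ "vector [1, 0]"]) (auto simp: vec_eq_iff forall_2)
    qed
  qed
  then show ?thesis unfolding eigenvalues_def eq by simp
qed

lemma linear_saddle_ham_field:
  assumes "0 < a\<^sup>2 + b * c"
  shows "linear_saddle (ham_field a b c e f)"
proof -
  define r where "r = sqrt (a\<^sup>2 + b * c)"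
  have r: "0 < r" "a\<^sup>2 + b * c = r\<^sup>2" using assms by (auto simp: r_def)
  have "eigenvalues (vector [vector [a, b], vector [c, - a]]) = {complex_of_real (- r), complex_of_real r}"
    unfolding eigenvalues_trace_free r(2) of_real_power power2_eq_iff by auto
  then show ?thesis
    unfolding linear_saddle_def ham_field_affine using r(1) 
    by (metis neg_less_0_iff_less)
qed

lemma linear_center_ham_field:
  assumes "a\<^sup>2 + b * c < 0"
  shows "linear_center (ham_field a b c e f)"
proof -
  define r where "r = sqrt (- (a\<^sup>2 + b * c))"
  have r: "r \<noteq> 0" "a\<^sup>2 + b * c = - r\<^sup>2" using assms by (auto simp: r_def)
  have "complex_of_real (- r\<^sup>2) = (\<i> * complex_of_real r)\<^sup>2" by (simp add: power_mult_distrib)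
  then have "eigenvalues (vector [vector [a, b], vector [c, - a]]) =
      {\<i> * complex_of_real r, - (\<i> * complex_of_real r)}"
    unfolding eigenvalues_trace_free r(2) by (auto simp only: power2_eq_iff mem_Collect_eq insert_iff empty_iff)
  then show ?thesis
    unfolding linear_center_def ham_field_affine using r(1) by metis
qed

section \<open>Quadratic Hamiltonians on chords of the circle\<close>

text \<open>For a quadratic \<open>H\<close> the difference is exactly the gradient at the midpoint
  \<open>m\<close> paired with the chord. The chord is perpendicular to \<open>m\<close>, and a
  quarter turn of the gradient gives the Hamiltonian field, whence the pairing with
  \<open>m\<close>. The factor \<open>\<mu>\<close> comes from the chord alone, so it is common to
  all these Hamiltonians.\<close>

lemma ham_diff_S1:
  assumes "z \<in> S1" "w \<in> S1" "z + w \<noteq> 0"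
  obtains \<mu> where "\<mu> = 0 \<Longrightarrow> z = w"
    "\<And>a b c e f. ham a b c e f z - ham a b c e f w =
      \<mu> * (ham_field a b c e f ((1/2) *\<^sub>R (z + w)) \<bullet> ((1/2) *\<^sub>R (z + w)))"
proof -
  define s where "s = (z $ 1 + w $ 1) / 2"
  define t where "t = (z $ 2 + w $ 2) / 2"
  \<comment> \<open>\<open>\<mu>\<close> is the coefficient of \<open>z - w\<close> along
    \<open>(t, -s)\<close>, the vector perpendicular to the midpoint \<open>(s, t)\<close>.\<close>
  define \<mu> where "\<mu> = ((z $ 1 - w $ 1) * t - (z $ 2 - w $ 2) * s) / (s\<^sup>2 + t\<^sup>2)"
  have "s \<noteq> 0 \<or> t \<noteq> 0" using assms(3) by (simp add: s_def t_def vec_eq_iff forall_2)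
  then have pos: "s\<^sup>2 + t\<^sup>2 \<noteq> 0" by (simp add: sum_power2_eq_zero_iff)
  have orth: "(z $ 1 - w $ 1) * s + (z $ 2 - w $ 2) * t = 0"
    using assms(1,2) by (simp add: S1_def s_def t_def field_simps power2_eq_square)
  have h1: "(z $ 1 - w $ 1) * (s\<^sup>2 + t\<^sup>2) = (\<mu> * t) * (s\<^sup>2 + t\<^sup>2)"
    using pos orth by (simp add: \<mu>_def del: mult_cancel_right mult_cancel_left) algebra
  have 1: "z $ 1 - w $ 1 = \<mu> * t" by (rule iffD1[OF mult_right_cancel[OF pos] h1])
  have h2: "(z $ 2 - w $ 2) * (s\<^sup>2 + t\<^sup>2) = (- \<mu> * s) * (s\<^sup>2 + t\<^sup>2)"
    using pos orth by (simp add: \<mu>_def del: mult_cancel_right mult_cancel_left) algebra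
  have 2: "z $ 2 - w $ 2 = - \<mu> * s" by (rule iffD1[OF mult_right_cancel[OF pos] h2])
  have m: "((1/2) *\<^sub>R (z + w)) $ 1 = s" "((1/2) *\<^sub>R (z + w)) $ 2 = t" by (simp_all add: s_def t_def)
  have zw: "z $ 1 = s + \<mu> * t / 2" "w $ 1 = s - \<mu> * t / 2" "z $ 2 = t - \<mu> * s / 2" "w $ 2 = t + \<mu> * s / 2"
  proof -
    have "z $ 1 + w $ 1 = 2 * s" "z $ 2 + w $ 2 = 2 * t" by (simp_all add: s_def t_def)
    then show "z $ 1 = s + \<mu> * t / 2" "w $ 1 = s - \<mu> * t / 2" "z $ 2 = t - \<mu> * s / 2" "w $ 2 = t + \<mu> * s / 2"
      using 1 2 by simp_all
  qed
  show thesis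
  proof (rule that[of \<mu>])
    show "z = w" if "\<mu> = 0" using 1 2 that by (simp add: vec_eq_iff forall_2)
    show "ham a b c e f z - ham a b c e f w = \<mu> * (ham_field a b c e f ((1/2) *\<^sub>R (z + w)) \<bullet> ((1/2) *\<^sub>R (z + w)))"
      for a b c e f
      unfolding ham_def ham_field_def inner_vec_def sum_2 m vector_2 inner_real_def zw
      by (simp add: field_simps power2_eq_square)
  qed
qed

text \<open>Across a short chord near \<open>p\<close> both Hamiltonian differences carry the same
  \<open>\<mu>\<close>, multiplied by quantities of sign \<open>\<sigma>\<close> because the
  midpoint is near \<open>p\<close> too. Hence both Hamiltonians order the points of the arc alike,
  and \<open>\<mu> = 0\<close> only for equal points.\<close>

lemma ham_comonotone:
  fixes a b c e f a' b' c' e' f' :: real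
  defines "X \<equiv> ham_field a b c e f" and "HX \<equiv> ham a b c e f"
    and "Y \<equiv> ham_field a' b' c' e' f'" and "HY \<equiv> ham a' b' c' e' f'"
  assumes p: "crosses X Y \<sigma> p" "\<sigma> = 1 \<or> \<sigma> = -1" and K: "open K" "p \<in> K"
  obtains r where "0 < r" "ball p r \<subseteq> K" "\<And>z. z \<in> ball p r \<inter> S1 \<Longrightarrow> crosses X Y \<sigma> z"
    "\<And>z w. z \<in> ball p r \<inter> S1 \<Longrightarrow> w \<in> ball p r \<inter> S1 \<Longrightarrow> HX z \<le> HX w \<longleftrightarrow> HY z \<le> HY w"
    "inj_on HY (ball p r \<inter> S1)"
proof -
  have cont: "continuous_on UNIV X" "continuous_on UNIV Y"
    unfolding X_def Y_def using lipschitz_ham_field lipschitz_on_continuous_on by blast+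
  define G where "G = {z. 0 < \<sigma> * (X z \<bullet> z)} \<inter> {z. 0 < \<sigma> * (Y z \<bullet> z)} \<inter> K"
  have "open G"
    unfolding G_def by (intro open_Int open_Collect_less continuous_intros cont K)
  moreover have "p \<in> G" using p(1) K by (simp add: G_def crosses_def)
  ultimately obtain r where r: "0 < r" "ball p r \<subseteq> G" by (meson open_contains_ball)
  have mid: "\<exists>\<mu> x y. (\<mu> = 0 \<longrightarrow> z = w) \<and> 0 < \<sigma> * x \<and> 0 < \<sigma> * y \<and> HX z - HX w = \<mu> * x \<and> HY z - HY w = \<mu> * y"
    if zw: "z \<in> ball p r \<inter> S1" "w \<in> ball p r \<inter> S1" for z w
  proof -
    let ?m = "(1/2) *\<^sub>R (z + w)"
    have "?m = (1 - 1/2) *\<^sub>R z + (1/2) *\<^sub>R w" by (simp add: scaleR_add_right)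
    then have "?m \<in> ball p r"
      using convexD_alt[OF convex_ball, of z p r w "1/2"] zw by auto
    then have m: "?m \<in> G" using r(2) by blast
    \<comment> \<open>If the midpoint were the origin, the pairings required positive in
      \<open>G\<close> would vanish.\<close>
    then have "z + w \<noteq> 0" by (auto simp: G_def)
    then obtain \<mu> where "\<mu> = 0 \<Longrightarrow> z = w"
      "\<And>a b c e f. ham a b c e f z - ham a b c e f w = \<mu> * (ham_field a b c e f ?m \<bullet> ?m)"
      using ham_diff_S1 zw by (metis IntD2)
    then show ?thesis
      using m unfolding G_def HX_def HY_def X_def Y_def
      by (intro exI[of _ \<mu>] exI[of _ "ham_field a b c e f ?m \<bullet> ?m"] exI[of _ "ham_field a' b' c' e' f' ?m \<bullet> ?m"]) auto
  qed
  show thesis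
  proof (rule that[OF r(1)])
    show "ball p r \<subseteq> K" using r(2) by (auto simp: G_def)
    show "crosses X Y \<sigma> z" if "z \<in> ball p r \<inter> S1" for z
      using that r(2) by (auto simp: crosses_def G_def)
    show "HX z \<le> HX w \<longleftrightarrow> HY z \<le> HY w" if zw: "z \<in> ball p r \<inter> S1" "w \<in> ball p r \<inter> S1" for z w
    proof -
      obtain \<mu> x y where *: "0 < \<sigma> * x" "0 < \<sigma> * y" "HX z - HX w = \<mu> * x" "HY z - HY w = \<mu> * y"
        using mid[OF zw] by blast
      have "HX z \<le> HX w \<longleftrightarrow> \<mu> * x \<le> 0" "HY z \<le> HY w \<longleftrightarrow> \<mu> * y \<le> 0" using *(3,4) by linarith+
      then show ?thesis using *(1,2) p(2) by (auto simp: mult_le_0_iff)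
    qed
    show "inj_on HY (ball p r \<inter> S1)"
    proof (rule inj_onI)
      fix z w assume zw: "z \<in> ball p r \<inter> S1" "w \<in> ball p r \<inter> S1" and eq: "HY z = HY w"
      obtain \<mu> y where "\<mu> = 0 \<longrightarrow> z = w" "0 < \<sigma> * y" "HY z - HY w = \<mu> * y"
        using mid[OF zw] by blast
      then show "z = w" using eq by auto
    qed
  qed
qed

section \<open>Construction of crossing cycles\<close>

lemma arc_of_cong:
  assumes "arc_of W \<gamma> a b" "\<And>t. t \<in> {a..b} \<Longrightarrow> \<delta> t = \<gamma> t"
  shows "arc_of W \<delta> a b"
  unfolding arc_of_def
proof
  fix t assume t: "t \<in> {a..b}"
  then have "(\<gamma> has_vector_derivative W (\<delta> t)) (at t within {a..b})"
    using assms by (simp add: arc_of_def)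
  then show "(\<delta> has_vector_derivative W (\<delta> t)) (at t within {a..b})"
    by (rule has_vector_derivative_transform[OF t, rotated]) (use assms(2) in auto)
qed

text \<open>A smooth field is treated as a piecewise field with equal halves, so the crossing lemmas
  apply. The curve reaches its next zero of \<open>h\<close> from the side of sign
  \<open>\<sigma>\<close>, and so cannot cross there in direction \<open>\<sigma>\<close>
  again.\<close>

lemma arc_of_first_hit:
  assumes arc: "arc_of W \<zeta> 0 s" "0 < s" and W: "continuous_on UNIV W"
    and cr: "crosses W W \<sigma> (\<zeta> 0)" and s: "\<sigma> * hfun (\<zeta> s) \<le> 0"
  obtains t where "0 < t" "t \<le> s" "\<zeta> t \<in> S1" "\<And>u. 0 < u \<Longrightarrow> u < t \<Longrightarrow> 0 < \<sigma> * hfun (\<zeta> u)"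
    "\<not> crosses W W \<sigma> (\<zeta> t)"
proof -
  have \<sigma>: "\<sigma> \<noteq> 0" using cr by (auto simp: crosses_def)
  have sol: "filippov_solution W W \<zeta> 0 s"
    by (rule arc_of_filippov_solution[OF arc(1) less_imp_le[OF arc(2)] W]) (simp add: filippov_set_def)
  let ?f = "\<lambda>t. \<sigma> * hfun (\<zeta> t)"
  have f: "continuous_on {0..s} ?f"
    by (intro continuous_on_mult continuous_on_const continuous_on_hfun filippov_solution_continuous[OF sol])
  obtain \<epsilon> where e: "\<epsilon> > 0" "\<And>t. t \<in> {0..s} \<Longrightarrow> 0 < t \<Longrightarrow> t < 0 + \<epsilon> \<Longrightarrow> 0 < ?f t"
    by (rule crosses_sign_change[OF cr W W sol]) (use arc(2) in auto)
  \<comment> \<open>The function vanishes at time 0, so the search for the next zero starts slightly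
    later, where it is positive.\<close>
  define t0 where "t0 = min (\<epsilon> / 2) s"
  have t0: "0 < t0" "t0 \<le> s" "t0 < \<epsilon>" using e(1) arc(2) by (auto simp: t0_def)
  obtain t where t: "t0 < t" "t \<le> s" "?f t = 0" "\<And>u. t0 \<le> u \<Longrightarrow> u < t \<Longrightarrow> 0 < ?f u"
    by (rule first_zero_right[of t0 s ?f])
       (use t0 s e(2)[of t0] in \<open>auto intro!: continuous_on_subset[OF f]\<close>)
  have pos: "0 < ?f u" if "0 < u" "u < t" for u
    using e(2)[of u] t(4)[of u] t(2) t0 that by (cases "u \<le> t0") auto
  have "\<not> crosses W W \<sigma> (\<zeta> t)"
  proof
    assume "crosses W W \<sigma> (\<zeta> t)"
    then obtain \<epsilon>' where e': "\<epsilon>' > 0" "\<And>u. u \<in> {0..s} \<Longrightarrow> u < t \<Longrightarrow> t - \<epsilon>' < u \<Longrightarrow> ?f u < 0"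
      by (rule crosses_sign_change[OF _ W W sol]) (use t t0 in auto)
    define u where "u = max (t - \<epsilon>' / 2) t0"
    have "t0 \<le> u" "u < t" "t - \<epsilon>' < u" using e'(1) t(1) by (auto simp: u_def)
    then show False using e'(2)[of u] pos[of u] t(2) t0 by auto
  qed
  then show thesis
    using that[of t] t t0 pos \<sigma> by (simp add: mem_S1_iff)
qed

text \<open>No hitting time is computed. Each arc ends on the circle or on its other side, so it has
  a first hit; that point lies on the level set of the start, whose only circle points are
  \<open>p\<close> and \<open>q\<close>, and the start itself is excluded by the direction of
  crossing.\<close>

lemma crossing_cycle_exists:
  assumes cont: "continuous_on UNIV X" "continuous_on UNIV Y"
    and int: "first_integral HX X" "first_integral HY Y"
    and cr: "crosses X Y 1 p" "crosses X Y (-1) q"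
    and \<zeta>: "arc_of Y \<zeta> 0 s" "0 < s" "\<zeta> 0 = p" "hfun (\<zeta> s) \<le> 0"
    and \<xi>: "arc_of X \<xi> 0 u" "0 < u" "\<xi> 0 = q" "0 \<le> hfun (\<xi> u)"
    and levelY: "\<And>z. z \<in> S1 \<Longrightarrow> HY z = HY p \<Longrightarrow> z = p \<or> z = q"
    and levelX: "\<And>z. z \<in> S1 \<Longrightarrow> HX z = HX q \<Longrightarrow> z = p \<or> z = q"
  obtains \<gamma> T where "crossing_loop X Y \<gamma> T" "concatenation_of_arcs X Y \<gamma> T"
    "\<gamma> ` {0..T} \<inter> S1 = {p, q}" "\<And>z. z \<in> \<gamma> ` {0..T} \<Longrightarrow> 0 < hfun z \<Longrightarrow> HY z = HY p"
proof -
  have S1: "p \<in> S1" "q \<in> S1" using cr by (auto simp: crosses_def)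
  have "crosses Y Y 1 (\<zeta> 0)" "1 * hfun (\<zeta> s) \<le> 0" using cr \<zeta> by (auto simp: crosses_def)
  then obtain t1 where t1: "0 < t1" "t1 \<le> s" "\<zeta> t1 \<in> S1" "\<not> crosses Y Y 1 (\<zeta> t1)"
    and pos1: "\<And>u. 0 < u \<Longrightarrow> u < t1 \<Longrightarrow> 0 < 1 * hfun (\<zeta> u)"
    using arc_of_first_hit[OF \<zeta>(1,2) cont(2), of 1] by metis
  have "HY (\<zeta> t1) = HY p" using first_integral_arc[OF int(2) \<zeta>(1), of t1] t1 \<zeta>(3) by simp
  moreover have "\<zeta> t1 \<noteq> p" using t1(4) cr(1) by (auto simp: crosses_def)
  ultimately have \<zeta>1: "\<zeta> t1 = q" using levelY[of "\<zeta> t1"] t1(3) by blast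
  have "crosses X X (-1) (\<xi> 0)" "(-1) * hfun (\<xi> u) \<le> 0" using cr \<xi> by (auto simp: crosses_def)
  then obtain t2 where t2: "0 < t2" "t2 \<le> u" "\<xi> t2 \<in> S1" "\<not> crosses X X (-1) (\<xi> t2)"
    and pos2: "\<And>u. 0 < u \<Longrightarrow> u < t2 \<Longrightarrow> 0 < (-1) * hfun (\<xi> u)"
    using arc_of_first_hit[OF \<xi>(1,2) cont(1), of "-1"] by metis
  have "HX (\<xi> t2) = HX q" using first_integral_arc[OF int(1) \<xi>(1), of t2] t2 \<xi>(3) by simp
  moreover have "\<xi> t2 \<noteq> q" using t2(4) cr(2) by (auto simp: crosses_def)
  ultimately have \<xi>2: "\<xi> t2 = p" using levelX[of "\<xi> t2"] t2(3) by blast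
  define \<gamma> where "\<gamma> = (\<lambda>t. if t \<le> t1 then \<zeta> t else \<xi> (t - t1))"
  define T where "T = t1 + t2"
  have T: "t1 < T" using t2(1) by (simp add: T_def)
  have \<gamma>1: "\<gamma> t = \<zeta> t" if "t \<le> t1" for t using that by (simp add: \<gamma>_def)
  have \<gamma>2: "\<gamma> t = \<xi> (t - t1)" if "t1 \<le> t" for t
    using that \<zeta>1 \<xi>(3) by (cases "t = t1") (auto simp: \<gamma>_def)
  have "arc_of Y \<gamma> 0 t1"
    by (rule arc_of_cong[OF arc_of_subset[OF \<zeta>(1), of 0 t1]]) (use t1(1,2) in \<open>simp_all add: \<gamma>1\<close>)
  moreover have h1: "0 \<le> hfun (\<gamma> t)" if t: "t \<in> {0..t1}" for t
  proof -
    consider "t = 0" | "t = t1" | "0 < t" "t < t1" using t by fastforce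
    then show ?thesis
      using pos1[of t] \<gamma>1[of t] \<zeta>(3) \<zeta>1 S1 t1(1) by cases (simp_all add: mem_S1_iff)
  qed
  moreover have "arc_of X (\<lambda>t. \<xi> (t + - t1)) (0 - - t1) (t2 - - t1)"
    by (rule arc_of_shift[OF arc_of_subset[OF \<xi>(1)]]) (use t2(1,2) in simp_all)
  then have "arc_of X (\<lambda>t. \<xi> (t + - t1)) t1 T" by (simp add: T_def add.commute)
  then have "arc_of X \<gamma> t1 T"
    by (rule arc_of_cong) (simp add: \<gamma>2)
  moreover have h2: "hfun (\<gamma> t) \<le> 0" if t: "t \<in> {t1..T}" for t
  proof -
    consider "t = t1" | "t = T" | "t1 < t" "t < T" using t by fastforce
    then show ?thesis
      using pos2[of "t - t1"] \<gamma>2[of t] \<xi>(3) \<xi>2 S1 t2(1) T_def by cases (simp_all add: mem_S1_iff)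
  qed
  ultimately have conc: "concatenation_of_arcs X Y \<gamma> T"
    unfolding concatenation_of_arcs_def using t1(1) T
    by (intro exI[of _ 2] exI[of _ "\<lambda>i. if i = 0 then 0 else if i = 1 then t1 else T"])
       (auto simp: less_2_cases_iff)
  have ends: "\<gamma> 0 = p" "\<gamma> t1 = q" "\<gamma> T = p"
    using \<gamma>1[of 0] \<gamma>1[of t1] \<gamma>2[of T] t1(1) T \<zeta>(3) \<zeta>1 \<xi>2 by (auto simp: T_def)
  have im: "\<gamma> ` {0..T} \<inter> S1 = {p, q}"
  proof
    show "{p, q} \<subseteq> \<gamma> ` {0..T} \<inter> S1"
      using ends(1,2) t1(1) T S1 by (auto intro: image_eqI[of p \<gamma> 0] image_eqI[of q \<gamma> t1])
    show "\<gamma> ` {0..T} \<inter> S1 \<subseteq> {p, q}"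
    proof
      fix z assume "z \<in> \<gamma> ` {0..T} \<inter> S1"
      then obtain t where t: "t \<in> {0..T}" "z = \<gamma> t" "hfun (\<gamma> t) = 0" by (auto simp: mem_S1_iff)
      have "\<not> (0 < t \<and> t < t1)" using pos1[of t] \<gamma>1[of t] t(3) by auto
      moreover have "\<not> (t1 < t \<and> t < T)" using pos2[of "t - t1"] \<gamma>2[of t] t(3) by (auto simp: T_def)
      ultimately have "t = 0 \<or> t = t1 \<or> t = T" using t(1) by auto
      then show "z \<in> {p, q}" using ends t(2) by auto
    qed
  qed
  have "crossing_loop X Y \<gamma> T"
    unfolding crossing_loop_def
    using ends S1 t1(1) T im cr concatenation_filippov_solution[OF conc cont]
    by (auto simp: crossing_region_eq)
  moreover have "HY z = HY p" if z: "z \<in> \<gamma> ` {0..T}" "0 < hfun z" for z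
  proof -
    obtain t where t: "t \<in> {0..T}" "z = \<gamma> t" using z(1) by blast
    then have "t < t1" using h2[of t] z(2) by (cases "t < t1") auto
    then show ?thesis
      using first_integral_arc[OF int(2) \<zeta>(1), of t] t t1(2) \<gamma>1[of t] \<zeta>(3) by simp
  qed
  ultimately show thesis using that[of \<gamma> T] conc im by blast
qed

section \<open>Isolation of the constructed cycles\<close>

lemma arc_of_not_closed:
  assumes "arc_of W \<gamma> 0 T" "0 < T" "\<And>t. t \<in> {0..T} \<Longrightarrow> 0 < W (\<gamma> t) \<bullet> u"
  shows "\<gamma> T \<noteq> \<gamma> 0"
proof
  assume eq: "\<gamma> T = \<gamma> 0"
  have der: "((\<lambda>t. \<gamma> t \<bullet> u) has_vector_derivative W (\<gamma> t) \<bullet> u) (at t within {0..T})" if "t \<in> {0..T}" for t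
    using assms(1) that unfolding arc_of_def
    by (intro bounded_linear.has_vector_derivative[OF bounded_linear_inner_left]) auto
  have "\<gamma> 0 \<bullet> u < \<gamma> T \<bullet> u"
  proof (rule DERIV_pos_imp_increasing_open[OF assms(2)])
    show "\<exists>y. ((\<lambda>t. \<gamma> t \<bullet> u) has_real_derivative y) (at t) \<and> 0 < y" if "0 < t" "t < T" for t
      using der[of t] assms(3)[of t] that at_within_Icc_at[of 0 t T]
      by (auto simp: has_real_derivative_iff_has_vector_derivative)
    show "continuous_on {0..T} (\<lambda>t. \<gamma> t \<bullet> u)"
      by (rule continuous_on_vector_derivative[OF der])
  qed
  then show False using eq by simp
qed

text \<open>By connectedness an orbit missing the circle stays on one side and is a trajectory of
  one field. Its component along the fixed vector \<open>u\<close> or \<open>v\<close> then strictly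
  increases, so it cannot close up.\<close>

lemma periodic_orbit_meets_S1:
  assumes cont: "continuous_on UNIV X" "continuous_on UNIV Y"
    and per: "0 < T" "\<gamma> T = \<gamma> 0" and sol: "filippov_solution X Y \<gamma> 0 T"
    and inside: "\<And>z. z \<in> \<gamma> ` {0..T} \<Longrightarrow> hfun z < 0 \<Longrightarrow> 0 < X z \<bullet> u"
    and outside: "\<And>z. z \<in> \<gamma> ` {0..T} \<Longrightarrow> 0 < hfun z \<Longrightarrow> 0 < Y z \<bullet> v"
  shows "\<exists>s\<in>{0..T}. \<gamma> s \<in> S1"
proof (rule ccontr)
  assume "\<not> ?thesis"
  then have ne: "hfun (\<gamma> t) \<noteq> 0" if "t \<in> {0..T}" for t using that by (auto simp: mem_S1_iff)
  have conn: "connected ((\<lambda>t. hfun (\<gamma> t)) ` {0..T})"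
    by (intro connected_continuous_image continuous_on_hfun filippov_solution_continuous[OF sol]) auto
  have sgn: "(\<forall>t\<in>{0..T}. hfun (\<gamma> t) < 0) \<or> (\<forall>t\<in>{0..T}. 0 < hfun (\<gamma> t))"
  proof (rule ccontr)
    assume "\<not> ?thesis"
    then obtain s t where st: "s \<in> {0..T}" "t \<in> {0..T}" "0 \<le> hfun (\<gamma> s)" "hfun (\<gamma> t) \<le> 0"
      by (auto simp: not_less)
    have "0 \<in> (\<lambda>t. hfun (\<gamma> t)) ` {0..T}"
      by (rule connectedD_interval[OF conn, of "hfun (\<gamma> t)" "hfun (\<gamma> s)"]) (use st in auto)
    then show False using ne by auto
  qed
  then show False
  proof
    assume neg: "\<forall>t\<in>{0..T}. hfun (\<gamma> t) < 0"
    have "arc_of X \<gamma> 0 T"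
      by (rule filippov_solution_arc_of[OF sol cont(1)]) (use neg in \<open>auto simp: filippov_set_def\<close>)
    then show False
      using arc_of_not_closed[of X \<gamma> T u] per inside neg by auto
  next
    assume pos: "\<forall>t\<in>{0..T}. 0 < hfun (\<gamma> t)"
    have "filippov_set X Y (\<gamma> t) = {Y (\<gamma> t)}" if "0 < t" "t < T" for t
      using bspec[OF pos, of t] that by (auto simp: filippov_set_def)
    then have "arc_of Y \<gamma> 0 T"
      by (rule filippov_solution_arc_of[OF sol cont(2)])
    then show False
      using arc_of_not_closed[of Y \<gamma> T v] per outside pos by auto
  qed
qed

text \<open>The open set \<open>K\<close> contains the outer arc and both crossing points; it is
  chosen so that \<open>Y\<close> has positive component along \<open>v\<close> on its outer part
  and no second solution pair starts in it. The component of \<open>X\<close> along \<open>u\<close>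
  is positive on the entire open disc, so the neighbourhood can include all of it.\<close>

lemma ham_crossing_limit_cycle:
  fixes a b c e f a' b' c' e' f' :: real
  defines "X \<equiv> ham_field a b c e f" and "HX \<equiv> ham a b c e f"
    and "Y \<equiv> ham_field a' b' c' e' f'" and "HY \<equiv> ham a' b' c' e' f'"
  assumes cr: "crosses X Y 1 p" "crosses X Y (-1) q"
    and \<zeta>: "arc_of Y \<zeta> 0 s" "0 < s" "\<zeta> 0 = p" "hfun (\<zeta> s) \<le> 0"
    and \<xi>: "arc_of X \<xi> 0 t" "0 < t" "\<xi> 0 = q" "0 \<le> hfun (\<xi> t)"
    and levelY: "\<And>z. z \<in> S1 \<Longrightarrow> HY z = HY p \<Longrightarrow> z = p \<or> z = q"
    and levelX: "\<And>z. z \<in> S1 \<Longrightarrow> HX z = HX q \<Longrightarrow> z = p \<or> z = q"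
    and K: "open K" "p \<in> K" "q \<in> K" "\<And>z. HY z = HY p \<Longrightarrow> 0 < hfun z \<Longrightarrow> z \<in> K"
    and outside: "\<And>z. z \<in> K \<Longrightarrow> 0 < hfun z \<Longrightarrow> 0 < Y z \<bullet> v"
    and inside: "\<And>z. hfun z < 0 \<Longrightarrow> 0 < X z \<bullet> u"
    and uniq: "\<And>z w. z \<in> K \<Longrightarrow> w \<in> K \<Longrightarrow> crosses X Y 1 z \<Longrightarrow> crosses X Y (-1) w \<Longrightarrow>
      HX z = HX w \<Longrightarrow> HY z = HY w \<Longrightarrow> z = p \<and> w = q"
  obtains \<gamma> T where "crossing_loop X Y \<gamma> T" "crossing_limit_cycle X Y (\<gamma> ` {0..T})"
    "\<gamma> ` {0..T} \<inter> S1 = {p, q}"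
proof -
  obtain L M where lip: "L-lipschitz_on UNIV X" "M-lipschitz_on UNIV Y"
    unfolding X_def Y_def using lipschitz_ham_field by meson
  note cont = lipschitz_on_continuous_on[OF lip(1)] lipschitz_on_continuous_on[OF lip(2)]
  have int: "first_integral HX X" "first_integral HY Y"
    unfolding X_def Y_def HX_def HY_def by (rule first_integral_ham)+
  obtain \<gamma> T where loop: "crossing_loop X Y \<gamma> T" and conc: "concatenation_of_arcs X Y \<gamma> T"
    and im: "\<gamma> ` {0..T} \<inter> S1 = {p, q}"
    and out: "\<And>z. z \<in> \<gamma> ` {0..T} \<Longrightarrow> 0 < hfun z \<Longrightarrow> HY z = HY p"
    by (rule crossing_cycle_exists[OF cont int cr \<zeta> \<xi> levelY levelX]) auto
  let ?\<Gamma> = "\<gamma> ` {0..T}"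
  obtain r where r: "0 < r" "ball p r \<subseteq> K" "\<And>z. z \<in> ball p r \<inter> S1 \<Longrightarrow> crosses X Y 1 z"
    "\<And>z w. z \<in> ball p r \<inter> S1 \<Longrightarrow> w \<in> ball p r \<inter> S1 \<Longrightarrow> HX z \<le> HX w \<longleftrightarrow> HY z \<le> HY w"
    "inj_on HY (ball p r \<inter> S1)"
    unfolding X_def HX_def Y_def HY_def
    by (rule ham_comonotone[OF cr(1)[unfolded X_def Y_def] _ K(1,2)]) auto
  obtain r' where r': "0 < r'" "ball q r' \<subseteq> K" "\<And>z. z \<in> ball q r' \<inter> S1 \<Longrightarrow> crosses X Y (-1) z"
    "\<And>z w. z \<in> ball q r' \<inter> S1 \<Longrightarrow> w \<in> ball q r' \<inter> S1 \<Longrightarrow> HX z \<le> HX w \<longleftrightarrow> HY z \<le> HY w"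
    "inj_on HY (ball q r' \<inter> S1)"
    unfolding X_def HX_def Y_def HY_def
    by (rule ham_comonotone[OF cr(2)[unfolded X_def Y_def] _ K(1,3)]) auto
  \<comment> \<open>On the circle \<open>U\<close> consists of parts of the two small balls only, so
    every crossing of an orbit inside \<open>U\<close> falls where \<open>HX\<close> and
    \<open>HY\<close> are comonotone.\<close>
  define U where "U = {z. hfun z < 0} \<union> ball p r \<union> ball q r' \<union> ({z. 0 < hfun z} \<inter> K)"
  have "open U"
    unfolding U_def using K(1)
    by (intro open_Un open_Int open_Collect_less open_ball continuous_on_hfun continuous_intros)
  moreover have "?\<Gamma> \<subseteq> U"
  proof
    fix z assume z: "z \<in> ?\<Gamma>"
    consider "hfun z < 0" | "z \<in> S1" | "0 < hfun z" unfolding mem_S1_iff by linarith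
    then show "z \<in> U"
    proof cases
      case 2
      then have "z = p \<or> z = q" using z im by blast
      then show ?thesis using r(1) r'(1) by (auto simp: U_def)
    qed (use out[OF z] K(4)[of z] in \<open>auto simp: U_def\<close>)
  qed
  moreover have "\<Gamma>' = ?\<Gamma>" if \<Gamma>': "periodic_orbit X Y \<Gamma>'" "\<Gamma>' \<subseteq> U" for \<Gamma>'
  proof -
    obtain \<delta> S where \<delta>: "closed_nonconstant \<delta> S" "\<Gamma>' = \<delta> ` {0..S}" "filippov_solution X Y \<delta> 0 S"
      using \<Gamma>'(1) unfolding periodic_orbit_def by blast
    have S: "0 < S" "\<delta> S = \<delta> 0" using \<delta>(1) by (auto simp: closed_nonconstant_def)
    have sub: "\<delta> ` {0..S} \<subseteq> U" using \<Gamma>'(2) \<delta>(2) by simp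
    have outU: "0 < Y z \<bullet> v" if "z \<in> \<delta> ` {0..S}" "0 < hfun z" for z
    proof -
      have "z \<in> K" using subsetD[OF sub that(1)] that(2) r(2) r'(2) by (auto simp: U_def)
      then show ?thesis using that(2) by (rule outside)
    qed
    obtain s where s: "s \<in> {0..S}" "\<delta> s \<in> S1"
      using periodic_orbit_meets_S1[OF cont S \<delta>(3), of u v] inside outU by blast
    have PQ: "\<delta> ` {0..S} \<inter> S1 \<subseteq> (ball p r \<inter> S1) \<union> (ball q r' \<inter> S1)"
    proof
      fix z assume z: "z \<in> \<delta> ` {0..S} \<inter> S1"
      then have "z \<in> U" using sub by blast
      then show "z \<in> (ball p r \<inter> S1) \<union> (ball q r' \<inter> S1)"
        using z by (simp add: U_def mem_S1_iff)
    qed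
    then have "\<delta> ` {0..S} \<inter> S1 \<subseteq> crossing_region X Y"
      using r(3) r'(3) unfolding crossing_region_eq by blast
    then obtain \<eta> where \<eta>: "crossing_loop X Y \<eta> S" "\<eta> ` {0..S} = \<delta> ` {0..S}"
      by (rule crossing_loop_rotate[OF S \<delta>(3) _ s])
    have "\<eta> ` {0..S} \<inter> S1 = {p, q}"
    proof (rule isolated_loop[OF cont int \<eta>(1) PQ[folded \<eta>(2)] r(3) r'(3) r(4) r'(4) r(5) r'(5)])
      fix z w assume zw: "z \<in> ball p r \<inter> S1" "w \<in> ball q r' \<inter> S1" "HX z = HX w" "HY z = HY w"
      show "z = p \<and> w = q"
        by (rule uniq[OF _ _ r(3)[OF zw(1)] r'(3)[OF zw(2)] zw(3,4)]) (use zw r(2) r'(2) in auto)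
    qed
    then have "\<eta> ` {0..S} = ?\<Gamma>"
      using im by (intro crossing_loop_image_eq[OF lip \<eta>(1) loop]) simp
    then show ?thesis using \<eta>(2) \<delta>(2) by simp
  qed
  moreover have "crossing_periodic_orbit X Y ?\<Gamma>"
  proof -
    have "p \<noteq> q" using cr crosses_opposite[of X Y 1 q] by auto
    moreover have "p \<in> ?\<Gamma>" "q \<in> ?\<Gamma>" using im by auto
    ultimately have "\<exists>t\<in>{0..T}. \<gamma> t \<noteq> \<gamma> 0" by (metis imageE)
    then have "closed_nonconstant \<gamma> T"
      using loop by (auto simp: closed_nonconstant_def crossing_loop_def)
    then show ?thesis
      unfolding crossing_periodic_orbit_def using conc loop by (auto simp: crossing_loop_def)
  qed
  ultimately have "crossing_limit_cycle X Y ?\<Gamma>"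
    unfolding crossing_limit_cycle_def by blast
  then show thesis using that loop im by blast
qed

lemma vector_2_has_vector_derivative:
  assumes "(f has_vector_derivative f') F" "(g has_vector_derivative g') F"
  shows "((\<lambda>t. vector [f t, g t] :: plane) has_vector_derivative vector [f', g']) F"
proof -
  have "(vector [x, y] :: plane) = x *\<^sub>R axis 1 1 + y *\<^sub>R axis 2 1" for x y
    by (simp add: vec_eq_iff forall_2 axis_def)
  then show ?thesis
    by (simp only:) (intro has_vector_derivative_add assms
        bounded_linear.has_vector_derivative[OF bounded_linear_scaleR_left])
qed

section \<open>The example\<close>

text \<open>The saddle sits at \<open>(2, 2/5)\<close>, outside the disc, and the center at
  \<open>(-1/12, -9/35)\<close>, inside it: neither field has a singularity on the side where it
  governs the motion.\<close>

abbreviation "Xs \<equiv> ham_field (-1) 0 0 2 (-2/5)"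
abbreviation "HXs \<equiv> ham (-1) 0 0 2 (-2/5)"
abbreviation "Yc \<equiv> ham_field 0 7 (-6) (9/5) (-1/2)"
abbreviation "HYc \<equiv> ham 0 7 (-6) (9/5) (-1/2)"

lemma Yc_trajectory:
  obtains \<zeta> s where "arc_of Yc \<zeta> 0 s" "0 < s" "\<zeta> 0 = p" "\<zeta> s = p"
proof -
  \<comment> \<open>The squared angular frequency is \<open>7 * 6\<close>; around the center
    \<open>(-1/12, -9/35)\<close> the sine coefficients \<open>7 / w\<close> and
    \<open>6 / w\<close> appear as \<open>w / 6\<close> and \<open>w / 7\<close>.\<close>
  define w where "w = sqrt 42"
  have w: "0 < w" "w * w = 42" by (simp_all add: w_def)
  define \<zeta> :: "real \<Rightarrow> plane" where "\<zeta> = (\<lambda>t. vector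
    [-1/12 + (p $ 1 + 1/12) * cos (w * t) + w / 6 * (p $ 2 + 9/35) * sin (w * t),
     -9/35 + (p $ 2 + 9/35) * cos (w * t) - w / 7 * (p $ 1 + 1/12) * sin (w * t)])"
  have "(\<zeta> has_vector_derivative Yc (\<zeta> t)) (at t within A)" for t A
  proof -
    have "(\<zeta> has_vector_derivative vector
      [- (p $ 1 + 1/12) * (w * sin (w * t)) + w / 6 * (p $ 2 + 9/35) * (w * cos (w * t)),
       - (p $ 2 + 9/35) * (w * sin (w * t)) - w / 7 * (p $ 1 + 1/12) * (w * cos (w * t))]) (at t within A)"
      unfolding \<zeta>_def has_real_derivative_iff_has_vector_derivative[symmetric]
      by (intro vector_2_has_vector_derivative;
          simp only: has_real_derivative_iff_has_vector_derivative[symmetric];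
          auto intro!: derivative_eq_intros simp: algebra_simps)
    moreover have "vector
      [- (p $ 1 + 1/12) * (w * sin (w * t)) + w / 6 * (p $ 2 + 9/35) * (w * cos (w * t)),
       - (p $ 2 + 9/35) * (w * sin (w * t)) - w / 7 * (p $ 1 + 1/12) * (w * cos (w * t))] = Yc (\<zeta> t)"
    proof -
      have ww: "w * (w * x) = 42 * x" for x using w(2) by (metis mult.assoc)
      show ?thesis
        by (simp add: ham_field_def \<zeta>_def vec_eq_iff forall_2) (simp add: algebra_simps ww)
    qed
    ultimately show ?thesis by simp
  qed
  then have "arc_of Yc \<zeta> 0 (2 * pi / w)" by (simp add: arc_of_def)
  moreover have "\<zeta> 0 = p" "\<zeta> (2 * pi / w) = p"
    using w(1) by (simp_all add: \<zeta>_def vec_eq_iff forall_2)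
  ultimately show thesis using that w(1) by simp
qed

lemma Xs_trajectory:
  "arc_of Xs (\<lambda>t. vector [2 + (q $ 1 - 2) * exp (- t), 2/5 + (q $ 2 - 2/5) * exp t]) a b"
  unfolding arc_of_def ham_field_def vector_2
  by (intro ballI vector_2_has_vector_derivative;
      simp only: has_real_derivative_iff_has_vector_derivative[symmetric];
      auto intro!: derivative_eq_intros simp: algebra_simps)

lemma Xs_Yc_in_X_S1_2: "(Xs, Yc) \<in> X_S1_2"
  by (simp add: X_S1_2_def linear_saddle_ham_field linear_center_ham_field divergence_ham_field)

section \<open>Chords, level sets and the possible pairs of crossing points\<close>

lemma S1_chord1:
  assumes "z \<in> S1" "z $ 1 + 2 * z $ 2 + 2 = 0"
  shows "z = vector [0, -1] \<or> z = vector [-4/5, -3/5]"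
proof -
  have x: "z $ 1 = - 2 - 2 * z $ 2" using assms(2) by simp
  then have "(5 * z $ 2 + 3) * (z $ 2 + 1) = 0"
    using assms(1) unfolding S1_def mem_Collect_eq by algebra
  then have "z $ 2 = -3/5 \<or> z $ 2 = -1" by auto
  then show ?thesis using x by (auto simp: vec_eq_iff forall_2)
qed

lemma S1_chord2:
  assumes "z \<in> S1" "z $ 1 + 3 * z $ 2 + 1 = 0"
  shows "z = vector [4/5, -3/5] \<or> z = vector [-1, 0]"
proof -
  have x: "z $ 1 = - 1 - 3 * z $ 2" using assms(2) by simp
  then have "2 * ((5 * z $ 2 + 3) * z $ 2) = 0"
    using assms(1) unfolding S1_def mem_Collect_eq by algebra
  then have "z $ 2 = -3/5 \<or> z $ 2 = 0" by auto
  then show ?thesis using x by (auto simp: vec_eq_iff forall_2)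
qed

lemma S1_bounds:
  assumes "z \<in> S1"
  shows "z $ 1 \<le> 1" "-1 \<le> z $ 1" "z $ 2 \<le> 1" "-1 \<le> z $ 2"
proof -
  have "(z $ 1)\<^sup>2 \<le> 1" "(z $ 2)\<^sup>2 \<le> 1"
    using assms zero_le_power2[of "z $ 1"] zero_le_power2[of "z $ 2"] by (simp_all only: S1_def mem_Collect_eq)
  then have "\<bar>z $ 1\<bar> \<le> 1" "\<bar>z $ 2\<bar> \<le> 1" by (simp_all add: abs_square_le_1)
  then show "z $ 1 \<le> 1" "-1 \<le> z $ 1" "z $ 2 \<le> 1" "-1 \<le> z $ 2" by auto
qed

text \<open>Modulo \<open>h\<close>, a level set through the two ends of a chord is a pair of lines,
  one of which carries the chord.\<close>

lemma HXs_pencil: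
  "HXs z - 2 = (z $ 1 + 2 * z $ 2 + 2) * (2/5 * z $ 1 + 1/5 * z $ 2 - 6/5) - 2/5 * hfun z"
  "HXs z - 2/5 = (z $ 1 + 3 * z $ 2 + 1) * (3/10 * z $ 1 + 1/10 * z $ 2 - 7/10) - 3/10 * hfun z"
  by (simp_all add: ham_def hfun_def field_simps power2_eq_square)

lemma HYc_pencil:
  "HYc z + 17/10 = (z $ 1 + 2 * z $ 2 + 2) * (1/10 * z $ 1 - 1/5 * z $ 2 - 7/10) - 31/10 * hfun z"
  "HYc z + 5/2 = (z $ 1 + 3 * z $ 2 + 1) * (1/20 * z $ 1 - 3/20 * z $ 2 - 11/20) - 61/20 * hfun z"
  by (simp_all add: ham_def hfun_def field_simps power2_eq_square)

text \<open>The region is a filled ellipse containing the level curves of both cycles, at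
  \<open>-17/10\<close> and \<open>-5/2\<close>. The bounds keep the second factor of each
  \<open>HYc_pencil\<close> identity negative.\<close>

lemma HYc_level_bounds:
  assumes "- 5/2 \<le> HYc z"
  shows "z $ 1 < 1" "- 6/5 < z $ 2"
proof -
  have le: "3 * (z $ 1)\<^sup>2 + 7/2 * (z $ 2)\<^sup>2 + 1/2 * z $ 1 + 9/5 * z $ 2 \<le> 5/2"
    using assms by (simp add: ham_def)
  show "z $ 1 < 1"
  proof (rule ccontr)
    assume "\<not> z $ 1 < 1"
    then have "1 \<le> (z $ 1)\<^sup>2" by (simp add: one_le_power)
    \<comment> \<open>This completes the square in the other coordinate, about the center of the
      ellipse.\<close>
    moreover have "0 \<le> (z $ 2 + 9/35)\<^sup>2" by simp
    ultimately show False using le \<open>\<not> z $ 1 < 1\<close> by (simp add: power2_eq_square algebra_simps)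
  qed
  show "- 6/5 < z $ 2"
  proof (rule ccontr)
    assume "\<not> - 6/5 < z $ 2"
    then have "(6/5) * (12/5) \<le> (- z $ 2) * (- 7/2 * z $ 2 - 9/5)" by (intro mult_mono) auto
    moreover have "0 \<le> (z $ 1 + 1/12)\<^sup>2" by simp
    ultimately show False using le by (simp add: power2_eq_square algebra_simps)
  qed
qed

text \<open>The midpoint satisfies the conic equations \<open>X0\<close> and \<open>Y0\<close>.
  Eliminating \<open>y\<close> leaves a quartic in \<open>x\<close>, \<open>Y0\<close> then gives
  \<open>y\<close>, and the outward condition at \<open>p\<close> decides which end of the chord is
  \<open>p\<close>.\<close>

lemma crossing_pairs:
  assumes cr: "crosses Xs Yc 1 p" "crosses Xs Yc (-1) q" and eq: "HXs p = HXs q" "HYc p = HYc q"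
  shows "p = vector [0, -1] \<and> q = vector [-4/5, -3/5] \<or> p = vector [4/5, -3/5] \<and> q = vector [-1, 0]"
proof -
  have S1: "p \<in> S1" "q \<in> S1" and ne: "p \<noteq> q" and Xp: "0 < Xs p \<bullet> p"
    using cr by (auto simp: crosses_def)
  have sum: "p + q \<noteq> 0"
  proof
    assume "p + q = 0"
    then have "q $ 1 = - p $ 1" "q $ 2 = - p $ 2" by (simp_all add: vec_eq_iff forall_2 add_eq_0_iff)
    \<comment> \<open>For antipodal points only the linear parts of the Hamiltonians survive in the
      differences, and these are linearly independent.\<close>
    then have "p $ 1 = 0 \<and> p $ 2 = 0" using eq by (simp add: ham_def)
    then show False using S1(1) by (simp add: S1_def)
  qed
  obtain \<mu> where \<mu>: "\<mu> = 0 \<Longrightarrow> p = q" "\<And>a b c e f. ham a b c e f p - ham a b c e f q =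
      \<mu> * (ham_field a b c e f ((1/2) *\<^sub>R (p + q)) \<bullet> ((1/2) *\<^sub>R (p + q)))"
    using ham_diff_S1[OF S1 sum] by metis
  define x where "x = (p $ 1 + q $ 1) / 2"
  define y where "y = (p $ 2 + q $ 2) / 2"
  have m: "((1/2) *\<^sub>R (p + q)) $ 1 = x" "((1/2) *\<^sub>R (p + q)) $ 2 = y" by (simp_all add: x_def y_def)
  have "ham_field a b c e f ((1/2) *\<^sub>R (p + q)) \<bullet> ((1/2) *\<^sub>R (p + q)) =
      (a * x + b * y + e) * x + (c * x - a * y + f) * y" for a b c e f
    unfolding ham_field_def inner_vec_def sum_2 m vector_2 by simp
  then have X0: "(2 - x) * x + (y - 2/5) * y = 0" and Y0: "(7 * y + 9/5) * x + (- 6 * x - 1/2) * y = 0"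
    using \<mu>(2)[of "-1" 0 0 2 "-2/5"] \<mu>(2)[of 0 7 "-6" "9/5" "-1/2"] eq \<mu>(1) ne by auto
  \<comment> \<open>Up to sign this is the resultant of \<open>X0\<close> and \<open>Y0\<close> with
    respect to \<open>y\<close>. The root 0 is the antipodal case, and 7/2 is too large for a
    midpoint in the disc.\<close>
  have "x * ((x + 2/5) * ((x + 1/10) * (x - 7/2))) = 0"
    using X0 Y0 by algebra
  then consider "x = 0" | "x = -2/5" | "x = -1/10" | "x = 7/2" by auto
  then consider "x = -2/5" "y = -4/5" | "x = -1/10" "y = -3/10"
  proof cases
    case 1
    then have "y = 0" using Y0 by simp
    then show ?thesis using 1 sum by (simp add: x_def y_def vec_eq_iff forall_2)
  next
    case 4
    then show ?thesis using S1_bounds[OF S1(1)] S1_bounds[OF S1(2)] by (simp add: x_def)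
  qed (use Y0 that in auto)
  then show ?thesis
  proof cases
    case 1
    then have q: "q $ 1 = - 4/5 - p $ 1" "q $ 2 = - 8/5 - p $ 2" by (simp_all add: x_def y_def field_simps)
    \<comment> \<open>Subtracting the circle equations of \<open>p\<close> and
      \<open>q = 2 m - p\<close> leaves the line carrying the chord.\<close>
    have "p $ 1 + 2 * p $ 2 + 2 = 0"
      using S1 by (simp add: S1_def q power2_eq_square algebra_simps)
    then have "p = vector [0, -1] \<or> p = vector [-4/5, -3/5]" by (rule S1_chord1[OF S1(1)])
    then show ?thesis
      using Xp q by (auto simp: ham_field_def inner_vec_def sum_2 vec_eq_iff forall_2)
  next
    case 2
    then have q: "q $ 1 = - 1/5 - p $ 1" "q $ 2 = - 3/5 - p $ 2" by (simp_all add: x_def y_def field_simps)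
    have "p $ 1 + 3 * p $ 2 + 1 = 0"
      using S1 by (simp add: S1_def q power2_eq_square algebra_simps)
    then have "p = vector [4/5, -3/5] \<or> p = vector [-1, 0]" by (rule S1_chord2[OF S1(1)])
    then show ?thesis
      using Xp q by (auto simp: ham_field_def inner_vec_def sum_2 vec_eq_iff forall_2)
  qed
qed

text \<open>\<open>Yc\<close> returns to \<open>p\<close> after a full turn, \<open>Xs\<close> has
  left the open disc by time \<open>ln 4\<close>, and \<open>K\<close> is the set where
  \<open>Yc\<close> has positive component along \<open>v\<close>, minus \<open>p'\<close>. The
  point \<open>p'\<close> is meant as the outward end of the other chord, removed so that one
  solution pair remains.\<close>

lemma Xs_Yc_crossing_limit_cycle:
  assumes cr: "crosses Xs Yc 1 p" "crosses Xs Yc (-1) q"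
    and q: "q $ 2 \<le> 0"
    and levelY: "\<And>z. z \<in> S1 \<Longrightarrow> HYc z = HYc p \<Longrightarrow> z = p \<or> z = q"
    and levelX: "\<And>z. z \<in> S1 \<Longrightarrow> HXs z = HXs q \<Longrightarrow> z = p \<or> z = q"
    and K: "0 < Yc p \<bullet> v" "0 < Yc q \<bullet> v" "\<And>z. HYc z = HYc p \<Longrightarrow> 0 < hfun z \<Longrightarrow> 0 < Yc z \<bullet> v"
    and p': "p' \<in> S1" "p' \<noteq> p" "p' \<noteq> q"
    and uniq: "\<And>z w. crosses Xs Yc 1 z \<Longrightarrow> crosses Xs Yc (-1) w \<Longrightarrow>
      HXs z = HXs w \<Longrightarrow> HYc z = HYc w \<Longrightarrow> z \<noteq> p' \<Longrightarrow> z = p \<and> w = q"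
  obtains \<gamma> T where "crossing_loop Xs Yc \<gamma> T" "crossing_limit_cycle Xs Yc (\<gamma> ` {0..T})"
    "\<gamma> ` {0..T} \<inter> S1 = {p, q}"
proof -
  obtain \<zeta> s where \<zeta>: "arc_of Yc \<zeta> 0 s" "0 < s" "\<zeta> 0 = p" "\<zeta> s = p"
    by (rule Yc_trajectory)
  define \<xi> :: "real \<Rightarrow> plane"
    where "\<xi> = (\<lambda>t. vector [2 + (q $ 1 - 2) * exp (- t), 2/5 + (q $ 2 - 2/5) * exp t])"
  have \<xi>: "arc_of Xs \<xi> 0 (ln 4)" unfolding \<xi>_def by (rule Xs_trajectory)
  have "\<xi> 0 = q" by (simp add: \<xi>_def vec_eq_iff forall_2)
  have "0 \<le> hfun (\<xi> (ln 4))"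
  proof -
    \<comment> \<open>The depth below the saddle's height \<open>2/5\<close> is at least
      \<open>2/5\<close> initially and grows fourfold, to at least \<open>8/5\<close>.\<close>
    have "6/5 \<le> - (\<xi> (ln 4) $ 2)" using q by (simp add: \<xi>_def)
    then have "(6/5)\<^sup>2 \<le> (- (\<xi> (ln 4) $ 2))\<^sup>2" by (intro power_mono) auto
    then show ?thesis by (simp add: hfun_def power2_eq_square add_increasing)
  qed
  have open_K: "open ({z. 0 < Yc z \<bullet> v} - {p'})"
  proof -
    have "continuous_on UNIV Yc" using lipschitz_ham_field lipschitz_on_continuous_on by blast
    then show ?thesis by (intro open_Diff open_Collect_less continuous_intros closed_singleton)
  qed
  have S1: "p \<in> S1" "q \<in> S1" using cr by (auto simp: crosses_def)
  show thesis
  proof (rule ham_crossing_limit_cycle[OF cr \<zeta>(1-3) _ \<xi> _ \<open>\<xi> 0 = q\<close> \<open>0 \<le> hfun (\<xi> (ln 4))\<close>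
        levelY levelX open_K, of v "vector [1, 0]"])
    show "hfun (\<zeta> s) \<le> 0" using \<zeta>(4) S1 by (simp add: mem_S1_iff)
    show "0 < Xs z \<bullet> vector [1, 0]" if "hfun z < 0" for z
    proof -
      have "(z $ 1)\<^sup>2 < 1" using that zero_le_power2[of "z $ 2"] unfolding hfun_def by linarith
      then have "z $ 1 < 1" by (simp add: abs_square_less_1 abs_less_iff)
      then show ?thesis by (simp add: ham_field_def inner_vec_def sum_2)
    qed
    show "z \<in> {z. 0 < Yc z \<bullet> v} - {p'}" if "HYc z = HYc p" "0 < hfun z" for z
      using K(3)[OF that] that(2) p'(1) by (auto simp: mem_S1_iff)
    show "z = p \<and> w = q"
      if "z \<in> {z. 0 < Yc z \<bullet> v} - {p'}" "crosses Xs Yc 1 z" "crosses Xs Yc (-1) w"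
        "HXs z = HXs w" "HYc z = HYc w" for z w
      using uniq[OF that(2-5)] that(1) by blast
  qed (use K(1,2) p'(2,3) that in auto)
qed

text \<open>The vector \<open>(-2/7, 1/6)\<close> makes \<open>Yc z \<bullet> v\<close> equal to
  \<open>- (x + 2 y)\<close> up to a constant, so its positivity defines a half-plane bounded by a
  parallel to the chord. The removed point is the outward end of the second chord.\<close>

lemma crossing_limit_cycle_chord1:
  obtains \<gamma> T where "crossing_loop Xs Yc \<gamma> T" "crossing_limit_cycle Xs Yc (\<gamma> ` {0..T})"
    "\<gamma> ` {0..T} \<inter> S1 = {vector [0, -1], vector [-4/5, -3/5]}"
proof (rule Xs_Yc_crossing_limit_cycle[of "vector [0, -1]" "vector [-4/5, -3/5]" "vector [-2/7, 1/6]" "vector [4/5, -3/5]"])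
  show "z = vector [0, -1] \<or> z = vector [-4/5, -3/5]" if "z \<in> S1" "HYc z = HYc (vector [0, -1])" for z
  proof -
    have "HYc z = -17/10" using that(2) by (simp add: ham_def)
    then have "(z $ 1 + 2 * z $ 2 + 2) * (1/10 * z $ 1 - 1/5 * z $ 2 - 7/10) = 0"
      using HYc_pencil(1)[of z] that(1) by (simp add: mem_S1_iff)
    moreover have "1/10 * z $ 1 - 1/5 * z $ 2 - 7/10 < 0" using S1_bounds[OF that(1)] by simp
    ultimately show ?thesis using S1_chord1[OF that(1)] by auto
  qed
  show "z = vector [0, -1] \<or> z = vector [-4/5, -3/5]" if "z \<in> S1" "HXs z = HXs (vector [-4/5, -3/5])" for z
  proof -
    have "HXs z = 2" using that(2) by (simp add: ham_def)
    then have "(z $ 1 + 2 * z $ 2 + 2) * (2/5 * z $ 1 + 1/5 * z $ 2 - 6/5) = 0"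
      using HXs_pencil(1)[of z] that(1) by (simp add: mem_S1_iff)
    moreover have "2/5 * z $ 1 + 1/5 * z $ 2 - 6/5 < 0" using S1_bounds[OF that(1)] by simp
    ultimately show ?thesis using S1_chord1[OF that(1)] by auto
  qed
  show "0 < Yc z \<bullet> vector [-2/7, 1/6]" if "HYc z = HYc (vector [0, -1])" "0 < hfun z" for z
  proof -
    have *: "HYc z = -17/10" using that(1) by (simp add: ham_def)
    \<comment> \<open>On this level the pencil identity equates the product with
      \<open>31/10 * hfun z\<close>; as the second factor is negative, the outer arc lies strictly
      beyond the chord.\<close>
    then have "0 < (z $ 1 + 2 * z $ 2 + 2) * (1/10 * z $ 1 - 1/5 * z $ 2 - 7/10)"
      using HYc_pencil(1)[of z] that(2) by simp
    moreover have "1/10 * z $ 1 - 1/5 * z $ 2 - 7/10 < 0" using HYc_level_bounds[of z] * by simp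
    ultimately have "z $ 1 + 2 * z $ 2 + 2 < 0" by (simp add: zero_less_mult_iff)
    then show ?thesis by (simp add: ham_field_def inner_vec_def sum_2)
  qed
  show "z = vector [0, -1] \<and> w = vector [-4/5, -3/5]"
    if "crosses Xs Yc 1 z" "crosses Xs Yc (-1) w" "HXs z = HXs w" "HYc z = HYc w" "z \<noteq> vector [4/5, -3/5]" for z w
    using crossing_pairs[OF that(1-4)] that(5) by blast
qed (use that in \<open>auto simp: crosses_def S1_def ham_field_def inner_vec_def sum_2 power2_eq_square vec_eq_iff forall_2\<close>)

text \<open>Here \<open>(-3/7, 1/6)\<close> turns \<open>Yc z \<bullet> v\<close> into
  \<open>- (x + 3 y)\<close> up to a constant. The point \<open>(0, -1)\<close> of the first cycle
  lies in the resulting half-plane, which is why it is removed.\<close>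

lemma crossing_limit_cycle_chord2:
  obtains \<gamma> T where "crossing_loop Xs Yc \<gamma> T" "crossing_limit_cycle Xs Yc (\<gamma> ` {0..T})"
    "\<gamma> ` {0..T} \<inter> S1 = {vector [4/5, -3/5], vector [-1, 0]}"
proof (rule Xs_Yc_crossing_limit_cycle[of "vector [4/5, -3/5]" "vector [-1, 0]" "vector [-3/7, 1/6]" "vector [0, -1]"])
  show "z = vector [4/5, -3/5] \<or> z = vector [-1, 0]" if "z \<in> S1" "HYc z = HYc (vector [4/5, -3/5])" for z
  proof -
    have "HYc z = -5/2" using that(2) by (simp add: ham_def power2_eq_square)
    then have "(z $ 1 + 3 * z $ 2 + 1) * (1/20 * z $ 1 - 3/20 * z $ 2 - 11/20) = 0"
      using HYc_pencil(2)[of z] that(1) by (simp add: mem_S1_iff)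
    moreover have "1/20 * z $ 1 - 3/20 * z $ 2 - 11/20 < 0" using S1_bounds[OF that(1)] by simp
    ultimately show ?thesis using S1_chord2[OF that(1)] by auto
  qed
  show "z = vector [4/5, -3/5] \<or> z = vector [-1, 0]" if "z \<in> S1" "HXs z = HXs (vector [-1, 0])" for z
  proof -
    have "HXs z = 2/5" using that(2) by (simp add: ham_def)
    then have "(z $ 1 + 3 * z $ 2 + 1) * (3/10 * z $ 1 + 1/10 * z $ 2 - 7/10) = 0"
      using HXs_pencil(2)[of z] that(1) unfolding mem_S1_iff by linarith
    moreover have "3/10 * z $ 1 + 1/10 * z $ 2 - 7/10 < 0" using S1_bounds[OF that(1)] by simp
    ultimately show ?thesis using S1_chord2[OF that(1)] by auto
  qed
  show "0 < Yc z \<bullet> vector [-3/7, 1/6]" if "HYc z = HYc (vector [4/5, -3/5])" "0 < hfun z" for z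
  proof -
    have *: "HYc z = -5/2" using that(1) by (simp add: ham_def power2_eq_square)
    then have "0 < (z $ 1 + 3 * z $ 2 + 1) * (1/20 * z $ 1 - 3/20 * z $ 2 - 11/20)"
      using HYc_pencil(2)[of z] that(2) by simp
    moreover have "1/20 * z $ 1 - 3/20 * z $ 2 - 11/20 < 0" using HYc_level_bounds[of z] * by simp
    ultimately have "z $ 1 + 3 * z $ 2 + 1 < 0" by (simp add: zero_less_mult_iff)
    then show ?thesis by (simp add: ham_field_def inner_vec_def sum_2)
  qed
  show "z = vector [4/5, -3/5] \<and> w = vector [-1, 0]"
    if "crosses Xs Yc 1 z" "crosses Xs Yc (-1) w" "HXs z = HXs w" "HYc z = HYc w" "z \<noteq> vector [0, -1]" for z w
    using crossing_pairs[OF that(1-4)] that(5) by blast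
qed (use that in \<open>auto simp: crosses_def S1_def ham_field_def inner_vec_def sum_2 power2_eq_square vec_eq_iff forall_2\<close>)

theorem corollary14:
  shows "\<exists>X Y. (X, Y) \<in> X_S1_2 \<and>
           card {\<Gamma>. crossing_limit_cycle X Y \<Gamma> \<and> card (\<Gamma> \<inter> S1) = 2} = 2"
proof (rule exI[of _ Xs], rule exI[of _ Yc], rule conjI)
  show "(Xs, Yc) \<in> X_S1_2" by (rule Xs_Yc_in_X_S1_2)
  obtain L M where lip: "L-lipschitz_on UNIV Xs" "M-lipschitz_on UNIV Yc"
    using lipschitz_ham_field by meson
  note cont = lipschitz_on_continuous_on[OF lip(1)] lipschitz_on_continuous_on[OF lip(2)]
  obtain \<gamma>1 T1 where 1: "crossing_loop Xs Yc \<gamma>1 T1" "crossing_limit_cycle Xs Yc (\<gamma>1 ` {0..T1})"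
    "\<gamma>1 ` {0..T1} \<inter> S1 = {vector [0, -1], vector [-4/5, -3/5]}"
    by (rule crossing_limit_cycle_chord1)
  obtain \<gamma>2 T2 where 2: "crossing_loop Xs Yc \<gamma>2 T2" "crossing_limit_cycle Xs Yc (\<gamma>2 ` {0..T2})"
    "\<gamma>2 ` {0..T2} \<inter> S1 = {vector [4/5, -3/5], vector [-1, 0]}"
    by (rule crossing_limit_cycle_chord2)
  have ne: "vector [0, -1] \<noteq> (vector [-4/5, -3/5] :: plane)" "vector [4/5, -3/5] \<noteq> (vector [-1, 0] :: plane)"
    "vector [0, -1] \<noteq> (vector [4/5, -3/5] :: plane)" "vector [0, -1] \<noteq> (vector [-1, 0] :: plane)"
    by (simp_all add: vec_eq_iff forall_2)
  have "{\<Gamma>. crossing_limit_cycle Xs Yc \<Gamma> \<and> card (\<Gamma> \<inter> S1) = 2} = {\<gamma>1 ` {0..T1}, \<gamma>2 ` {0..T2}}"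
  proof (intro equalityI subsetI)
    fix \<Gamma> assume "\<Gamma> \<in> {\<Gamma>. crossing_limit_cycle Xs Yc \<Gamma> \<and> card (\<Gamma> \<inter> S1) = 2}"
    then have \<Gamma>: "crossing_periodic_orbit Xs Yc \<Gamma>" "card (\<Gamma> \<inter> S1) = 2"
      by (auto simp: crossing_limit_cycle_def)
    then obtain \<delta> S where \<delta>: "closed_nonconstant \<delta> S" "\<Gamma> = \<delta> ` {0..S}" "concatenation_of_arcs Xs Yc \<delta> S"
      and sub: "\<Gamma> \<inter> S1 \<subseteq> crossing_region Xs Yc"
      unfolding crossing_periodic_orbit_def by blast
    \<comment> \<open>A circle point exists, and rebasing the orbit there turns it into a
      \<open>crossing_loop\<close>.\<close>
    have "\<Gamma> \<inter> S1 \<noteq> {}" using \<Gamma>(2) by auto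
    then obtain s where "s \<in> {0..S}" "\<delta> s \<in> S1" using \<delta>(2) by blast
    then obtain \<eta> where \<eta>: "crossing_loop Xs Yc \<eta> S" "\<eta> ` {0..S} = \<Gamma>"
      using crossing_loop_rotate[of S \<delta> Xs Yc s] concatenation_filippov_solution[OF \<delta>(3) cont]
        \<delta>(1,2) sub unfolding closed_nonconstant_def by metis
    obtain p q where pq: "\<Gamma> \<inter> S1 = {p, q}" "crosses Xs Yc 1 p" "crosses Xs Yc (-1) q"
      "HXs p = HXs q" "HYc p = HYc q"
      using two_point_loop[OF cont first_integral_ham first_integral_ham \<eta>(1)] \<eta>(2) \<Gamma>(2) by metis
    \<comment> \<open>\<open>crossing_pairs\<close> leaves two possible crossing sets, and a loop is
      determined by its crossing set.\<close>
    then have "\<Gamma> \<inter> S1 = \<gamma>1 ` {0..T1} \<inter> S1 \<or> \<Gamma> \<inter> S1 = \<gamma>2 ` {0..T2} \<inter> S1"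
      using crossing_pairs[OF pq(2-5)] 1(3) 2(3) by auto
    then show "\<Gamma> \<in> {\<gamma>1 ` {0..T1}, \<gamma>2 ` {0..T2}}"
      using crossing_loop_image_eq[OF lip \<eta>(1) 1(1)] crossing_loop_image_eq[OF lip \<eta>(1) 2(1)] \<eta>(2) by auto
  next
    fix \<Gamma> assume "\<Gamma> \<in> {\<gamma>1 ` {0..T1}, \<gamma>2 ` {0..T2}}"
    then show "\<Gamma> \<in> {\<Gamma>. crossing_limit_cycle Xs Yc \<Gamma> \<and> card (\<Gamma> \<inter> S1) = 2}"
      using 1(2,3) 2(2,3) ne by auto
  qed
  \<comment> \<open>The point \<open>(0, -1)\<close> of the circle lies on the first cycle but not
    on the second.\<close>
  moreover have "\<gamma>1 ` {0..T1} \<noteq> \<gamma>2 ` {0..T2}"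
    using 1(3) 2(3) ne by (metis insertI1 insertE singletonD)
  ultimately show "card {\<Gamma>. crossing_limit_cycle Xs Yc \<Gamma> \<and> card (\<Gamma> \<inter> S1) = 2} = 2"
    by simp
qed

end
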